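(* Assume (A0), (A1), (A2), (A3) and Conditions 1 and 2 (stated in the context) hold, that $\pi(\theta)\le\kappa$ for all $\theta$, for some $\kappa>0$, and that for the positive, data-dependent sequence $\hat\alpha_n$ there exists a positive sequence $\alpha_n$ with $\frac1n\ll\alpha_n\ll1$ such that $\hat\alpha_n/\alpha_n\to1$ in $f_{0,n}$-probability. Then, in $f_{0,n}$-probability, $$d_{\mathrm{TV}}\Big(\pi_{n,\hat\alpha_n}(\theta|X^n),\ \phi\Big(\theta\,\Big|\,\hat\theta,\tfrac{1}{\alpha_n n}V_{\theta^*}^{-1}\Big)\Big)\to0.$$
   Context: Setting. For each $n$, $X^n=(X_1,\dots,X_n)\in\mathcal X^n$ ($\mathcal X\subset\mathbb R^d$) is a random sample with true density $f_{0,n}$; $\mathbb P_{f_{0,n}}$ is the corresponding probability. $\{f_n(\cdot|\theta):\theta\in\Theta\subset\mathbb R^p\}$ is a parametric family of densities, possibly misspecified. $\hat\theta=\arg\max_\theta f_n(X^n|\theta)$ is the MLE and $\pi$ is a prior density. For $\alpha>0$ the $\alpha$-posterior has density $\pi_{n,\alpha}(\theta|X^n)=f_n(X^n|\theta)^\alpha\pi(\theta)/\int_{\mathbb R^p}f_n(X^n|\theta)^\alpha\pi(\theta)\,d\theta$; the $\hat\alpha_n$-posterior is obtained by plugging in a data-dependent $\hat\alpha_n$. All these posteriors are assumed proper. Integrands in $\theta$ are understood as zero outside $\Theta$. $\phi(\cdot|\mu,\Sigma)$ is the multivariate normal density. $d_{\mathrm{TV}}(f,g)=\frac12\int_{\mathbb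 R^p}|f(x)-g(x)|dx$ for densities $f,g$. $a_n\ll b_n$ means $a_n/b_n\to0$. $B_v(r)$, $\bar B_v(r)$ are open and closed Euclidean balls of radius $r$ centred at $v$. Assumptions; in (A2), (A3) $\alpha_n$ denotes an arbitrary positive sequence with $\frac1n\ll\alpha_n\ll1$. (A0) The MLE $\hat\theta$ is unique and there exists $\theta^*\in\Theta$, with $\Theta$ an open subset of $\mathbb R^p$, such that $\hat\theta\to\theta^*$ in $f_{0,n}$-probability and $\sqrt n(\hat\theta-\theta^* )$ is asymptotically normal. (A1) The prior $\pi$ is continuous and positive in an open ball around $\theta^*$. (A2) Let $\Delta_{n,\theta^*}=\sqrt n(\hat\theta-\theta^* )$. There exists a positive definite matrix $V_{\theta^*}$ such that $\sup_{h\in\bar B_0(r)}|R_n(h)|\to0$ in $f_{0,n}$-probability for any $r>0$, where $$R_n(h)=\alpha_n\Big[\log f_n\Big(X^n\Big|\theta^*+\tfrac{h}{\sqrt{\alpha_n n}}\Big)-\log f_n(X^n|\theta^* )\Big]-\sqrt{\alpha_n}\,h^\top V_{\theta^*}\Delta_{n,\theta^*}+\tfrac12h^\top V_{\theta^*}h.$$ (A3) For all $\epsilon>0$ and $k_0\ge0$ there exist a constant $M=M(k_0,\epsilon)<\infty$ and an integer $N=N(k_0,\epsilon)$ such that for $\alpha_n n\ge N$, $\mathbb P_{f_{0,n}}\big(\int_{\mathbb R^p}\|\sqrt{\alpha_n n}(\theta-\theta^* )\|_2^{k_0}\pi_{n,\alpha_n}(\theta|X^n)d\theta>M\big)<\epsilon$.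 Condition 1. There are constants $L,c_0,c_1>0$, $c_2\ge0$, some $r>e^{c_2/c_0}/c_1$, and a function $\gamma:[0,\infty)\to[0,\infty)$ with $\gamma(v)\ge c_0\log(1+c_1v)-c_2$ for $v\ge r$, such that with $f_{0,n}$-probability tending to one, uniformly over $\theta\in B_{\theta^*}(r)^{\mathsf c}$, $\log f_n(X^n|\theta)-\log f_n(X^n|\theta^* )\le-Ln\gamma(\|\theta-\theta^*\|_2)$. Condition 2. For the $c_0,c_1,c_2,r$ of Condition 1 there exist constants $c_3=c_3(r)>0$, $c_4=c_4(r)>0$ such that with $f_{0,n}$-probability tending to one, uniformly over $\theta\in B_{\hat\theta}(2r)$, $-nc_3\|\theta-\hat\theta\|_2^2\le\log f_n(X^n|\theta)-\log f_n(X^n|\hat\theta)\le-nc_4\|\theta-\hat\theta\|_2^2$. *)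

theory Defs
  imports "HOL-Probability.Probability"
begin

section \<open>Densities and the data-generating law\<close>

definition is_density :: "'a measure \<Rightarrow> ('a \<Rightarrow> real) \<Rightarrow> bool" where
  "is_density M g \<longleftrightarrow>
     g \<in> borel_measurable M \<and> (\<forall>x\<in>space M. 0 \<le> g x) \<and> (\<integral>\<^sup>+x. ennreal (g x) \<partial>M) = 1"

text \<open>
  A sample \<open>(X\<^sub>1, \<dots>, X\<^sub>n)\<close> is a function on the index set \<open>{1..n}\<close> (undefined elsewhere). Densities
  of samples are taken with respect to the \<open>n\<close>-fold product of a reference measure \<open>\<nu>\<close> on the
  observation space, e.g. Lebesgue measure restricted to it. The true density is a joint density
  that may vary with \<open>n\<close>; no product form is imposed.
\<close>

type_synonym 'd sample = "nat \<Rightarrow> real ^ 'd"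

definition sample_space :: "(real ^ 'd) measure \<Rightarrow> nat \<Rightarrow> 'd sample measure" where
  "sample_space \<nu> n = (\<Pi>\<^sub>M i\<in>{1..n}. \<nu>)"

definition true_law ::
  "(real ^ 'd) measure \<Rightarrow> (nat \<Rightarrow> 'd sample \<Rightarrow> real) \<Rightarrow> nat \<Rightarrow> 'd sample measure" where
  "true_law \<nu> f0 n = density (sample_space \<nu> n) (\<lambda>x. ennreal (f0 n x))"

section \<open>Modes of convergence\<close>

text \<open>
  Probabilities of events are taken in the sense of outer measure, which is the ordinary
  probability on measurable events and is also meaningful for events such as
  \<open>{sup\<^sub>h \<bar>R\<^sub>n(h)\<bar> > \<epsilon>}\<close>, whose measurability is not assumed. (The library's \<open>measure\<close> would be \<open>0\<close>
  on non-measurable sets.)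
\<close>

definition outer_prob :: "'a measure \<Rightarrow> ('a \<Rightarrow> bool) \<Rightarrow> ennreal" where
  "outer_prob M E = outer_measure_of M {x \<in> space M. E x}"

definition with_prob_tending_to_one ::
  "(nat \<Rightarrow> 'a measure) \<Rightarrow> (nat \<Rightarrow> 'a \<Rightarrow> bool) \<Rightarrow> bool" where
  "with_prob_tending_to_one P E \<longleftrightarrow> (\<lambda>n. outer_prob (P n) (\<lambda>x. \<not> E n x)) \<longlonglongrightarrow> 0"

definition tendsto_in_prob ::
  "(nat \<Rightarrow> 'a measure) \<Rightarrow> (nat \<Rightarrow> 'a \<Rightarrow> 'b::metric_space) \<Rightarrow> 'b \<Rightarrow> bool" where
  "tendsto_in_prob P Y c \<longleftrightarrow>
     (\<forall>\<epsilon>>0. (\<lambda>n. outer_prob (P n) (\<lambda>x. \<epsilon> < dist (Y n x) c)) \<longlonglongrightarrow> 0)"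

definition ereal_vanishes_in_prob ::
  "(nat \<Rightarrow> 'a measure) \<Rightarrow> (nat \<Rightarrow> 'a \<Rightarrow> ereal) \<Rightarrow> bool" where
  "ereal_vanishes_in_prob P Y \<longleftrightarrow>
     (\<forall>\<epsilon>>0. (\<lambda>n. outer_prob (P n) (\<lambda>x. ereal \<epsilon> < \<bar>Y n x\<bar>)) \<longlonglongrightarrow> 0)"

definition tendsto_in_distribution ::
  "(nat \<Rightarrow> 'a measure) \<Rightarrow> (nat \<Rightarrow> 'a \<Rightarrow> 'b::topological_space) \<Rightarrow> 'b measure \<Rightarrow> bool" where
  "tendsto_in_distribution P Y N \<longleftrightarrow>
     (\<forall>g :: 'b \<Rightarrow> real. continuous_on UNIV g \<and> bounded (range g) \<longrightarrow>
        (\<lambda>n. \<integral>x. g (Y n x) \<partial>P n) \<longlonglongrightarrow> (\<integral>z. g z \<partial>N))"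

section \<open>Normal densities and total variation\<close>

definition pos_def_matrix :: "real ^ 'p ^ 'p \<Rightarrow> bool" where
  "pos_def_matrix V \<longleftrightarrow> transpose V = V \<and> (\<forall>h. h \<noteq> 0 \<longrightarrow> 0 < h \<bullet> (V *v h))"

definition mvn_density ::
  "real ^ 'p \<Rightarrow> real ^ 'p ^ 'p \<Rightarrow> real ^ 'p \<Rightarrow> real" where
  "mvn_density \<mu> \<Sigma> \<theta> =
     exp (- (1/2) * ((\<theta> - \<mu>) \<bullet> (matrix_inv \<Sigma> *v (\<theta> - \<mu>)))) / sqrt ((2 * pi) ^ CARD('p) * det \<Sigma>)"

definition d_TV :: "('a::euclidean_space \<Rightarrow> real) \<Rightarrow> ('a \<Rightarrow> real) \<Rightarrow> real" where
  "d_TV f g = (1/2) * (\<integral>x. \<bar>f x - g x\<bar> \<partial>lborel)"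

section \<open>Model, MLE and posteriors\<close>

type_synonym ('d, 'p) model = "nat \<Rightarrow> 'd sample \<Rightarrow> real ^ 'p \<Rightarrow> real"

definition loglik :: "('d, 'p) model \<Rightarrow> nat \<Rightarrow> 'd sample \<Rightarrow> real ^ 'p \<Rightarrow> ereal" where
  "loglik f n x \<theta> = (if 0 < f n x \<theta> then ereal (ln (f n x \<theta>)) else - \<infinity>)"

text \<open>
  The value of the log-likelihood is \<open>-\<infinity>\<close> where the likelihood vanishes. Since \<open>-\<infinity> - (-\<infinity>) = \<infinity>\<close> in
  the extended reals, the bounds below fail on samples of likelihood zero under the reference
  parameter, rather than holding by accident as they could with the library's \<open>ln 0 = 0\<close>.
\<close>

definition loglik_ratio ::
  "('d, 'p) model \<Rightarrow> nat \<Rightarrow> 'd sample \<Rightarrow> real ^ 'p \<Rightarrow> real ^ 'p \<Rightarrow> ereal" where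
  "loglik_ratio f n x \<theta> \<theta>' = loglik f n x \<theta> - loglik f n x \<theta>'"

definition is_unique_MLE ::
  "(real ^ 'p) set \<Rightarrow> ('d, 'p) model \<Rightarrow> nat \<Rightarrow> 'd sample \<Rightarrow> real ^ 'p \<Rightarrow> bool" where
  "is_unique_MLE \<Theta> f n x t \<longleftrightarrow>
     is_arg_max (f n x) (\<lambda>\<theta>. \<theta> \<in> \<Theta>) t \<and> (\<forall>\<theta>. is_arg_max (f n x) (\<lambda>\<theta>. \<theta> \<in> \<Theta>) \<theta> \<longrightarrow> \<theta> = t)"

definition posterior_norm_const ::
  "(real ^ 'p) set \<Rightarrow> ('d, 'p) model \<Rightarrow> (real ^ 'p \<Rightarrow> real) \<Rightarrow> nat \<Rightarrow> real \<Rightarrow> 'd sample \<Rightarrow> real" where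
  "posterior_norm_const \<Theta> f \<pi> n a x = (LINT \<theta>:\<Theta>|lborel. f n x \<theta> powr a * \<pi> \<theta>)"

definition alpha_posterior ::
  "(real ^ 'p) set \<Rightarrow> ('d, 'p) model \<Rightarrow> (real ^ 'p \<Rightarrow> real) \<Rightarrow>
    nat \<Rightarrow> real \<Rightarrow> 'd sample \<Rightarrow> real ^ 'p \<Rightarrow> real" where
  "alpha_posterior \<Theta> f \<pi> n a x \<theta> =
     indicator \<Theta> \<theta> * (f n x \<theta> powr a * \<pi> \<theta>) / posterior_norm_const \<Theta> f \<pi> n a x"

definition proper_posterior ::
  "(real ^ 'p) set \<Rightarrow> ('d, 'p) model \<Rightarrow> (real ^ 'p \<Rightarrow> real) \<Rightarrow> nat \<Rightarrow> real \<Rightarrow> 'd sample \<Rightarrow> bool" where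
  "proper_posterior \<Theta> f \<pi> n a x \<longleftrightarrow>
     set_integrable lborel \<Theta> (\<lambda>\<theta>. f n x \<theta> powr a * \<pi> \<theta>) \<and> 0 < posterior_norm_const \<Theta> f \<pi> n a x"

text \<open>
  Standing assumptions. The parameter space is open, so that densities on it are understood with
  respect to Lebesgue measure. Properness holds almost surely, for all exponents simultaneously,
  so that it also covers exponents depending on the data. The empty sample \<open>n = 0\<close> is excluded
  throughout.
\<close>

definition model_setting ::
  "(real ^ 'd) set \<Rightarrow> (real ^ 'd) measure \<Rightarrow> (real ^ 'p) set \<Rightarrow> (nat \<Rightarrow> 'd sample \<Rightarrow> real) \<Rightarrow>
    ('d, 'p) model \<Rightarrow> (real ^ 'p \<Rightarrow> real) \<Rightarrow> bool" where
  "model_setting \<X> \<nu> \<Theta> f0 f \<pi> \<longleftrightarrow>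
     sets \<nu> = sets (restrict_space borel \<X>) \<and> sigma_finite_measure \<nu> \<and>
     open \<Theta> \<and>
     (\<forall>n\<ge>1. is_density (sample_space \<nu> n) (f0 n)) \<and>
     (\<forall>n\<ge>1. \<forall>\<theta>\<in>\<Theta>. is_density (sample_space \<nu> n) (\<lambda>x. f n x \<theta>)) \<and>
     is_density (restrict_space lborel \<Theta>) \<pi> \<and>
     (\<forall>n\<ge>1. AE x in true_law \<nu> f0 n. \<forall>a>0. proper_posterior \<Theta> f \<pi> n a x)"

definition admissible_exponents :: "(nat \<Rightarrow> real) \<Rightarrow> bool" where
  "admissible_exponents \<alpha> \<longleftrightarrow>
     (\<forall>n\<ge>1. 0 < \<alpha> n) \<and> (\<lambda>n. (1 / real n) / \<alpha> n) \<longlonglongrightarrow> 0 \<and> \<alpha> \<longlonglongrightarrow> 0"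

section \<open>The assumptions\<close>

definition assumption_A0 ::
  "(nat \<Rightarrow> 'd sample measure) \<Rightarrow> (real ^ 'p) set \<Rightarrow> ('d, 'p) model \<Rightarrow>
    (nat \<Rightarrow> 'd sample \<Rightarrow> real ^ 'p) \<Rightarrow> real ^ 'p \<Rightarrow> bool" where
  "assumption_A0 P \<Theta> f \<theta>hat \<theta>s \<longleftrightarrow>
     (\<forall>n\<ge>1. \<theta>hat n \<in> borel_measurable (P n)) \<and>
     (\<forall>n\<ge>1. AE x in P n. is_unique_MLE \<Theta> f n x (\<theta>hat n x)) \<and>
     \<theta>s \<in> \<Theta> \<and>
     tendsto_in_prob P \<theta>hat \<theta>s \<and>
     (\<exists>m \<Sigma>. pos_def_matrix \<Sigma> \<and>
        tendsto_in_distribution P (\<lambda>n x. sqrt (real n) *\<^sub>R (\<theta>hat n x - \<theta>s))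
          (density lborel (\<lambda>z. ennreal (mvn_density m \<Sigma> z))))"

definition assumption_A1 :: "(real ^ 'p \<Rightarrow> real) \<Rightarrow> real ^ 'p \<Rightarrow> bool" where
  "assumption_A1 \<pi> \<theta>s \<longleftrightarrow>
     (\<exists>\<delta>>0. continuous_on (ball \<theta>s \<delta>) \<pi> \<and> (\<forall>\<theta>\<in>ball \<theta>s \<delta>. 0 < \<pi> \<theta>))"

definition LAN_remainder ::
  "('d, 'p) model \<Rightarrow> (nat \<Rightarrow> 'd sample \<Rightarrow> real ^ 'p) \<Rightarrow> real ^ 'p \<Rightarrow> real ^ 'p ^ 'p \<Rightarrow>
    (nat \<Rightarrow> real) \<Rightarrow> nat \<Rightarrow> 'd sample \<Rightarrow> real ^ 'p \<Rightarrow> ereal" where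
  "LAN_remainder f \<theta>hat \<theta>s V \<alpha> n x h =
     ereal (\<alpha> n) * loglik_ratio f n x (\<theta>s + (1 / sqrt (\<alpha> n * real n)) *\<^sub>R h) \<theta>s
     - ereal (sqrt (\<alpha> n) * (h \<bullet> (V *v (sqrt (real n) *\<^sub>R (\<theta>hat n x - \<theta>s)))))
     + ereal ((1/2) * (h \<bullet> (V *v h)))"

text \<open>
  As the parameter space is open and \<open>\<alpha>\<^sub>n n\<close> tends to infinity, the arguments of the likelihood in
  the remainder lie in the parameter space for all large \<open>n\<close>, uniformly over \<open>h\<close> in a ball. The
  values of the model outside the parameter space are therefore immaterial.
\<close>

definition assumption_A2 ::
  "(nat \<Rightarrow> 'd sample measure) \<Rightarrow> ('d, 'p) model \<Rightarrow> (nat \<Rightarrow> 'd sample \<Rightarrow> real ^ 'p) \<Rightarrow>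
    real ^ 'p \<Rightarrow> real ^ 'p ^ 'p \<Rightarrow> bool" where
  "assumption_A2 P f \<theta>hat \<theta>s V \<longleftrightarrow>
     pos_def_matrix V \<and>
     (\<forall>\<alpha>. admissible_exponents \<alpha> \<longrightarrow>
        (\<forall>r>0. ereal_vanishes_in_prob P
           (\<lambda>n x. SUP h\<in>cball 0 r. \<bar>LAN_remainder f \<theta>hat \<theta>s V \<alpha> n x h\<bar>)))"

definition assumption_A3 ::
  "(nat \<Rightarrow> 'd sample measure) \<Rightarrow> (real ^ 'p) set \<Rightarrow> ('d, 'p) model \<Rightarrow> (real ^ 'p \<Rightarrow> real) \<Rightarrow>
    real ^ 'p \<Rightarrow> bool" where
  "assumption_A3 P \<Theta> f \<pi> \<theta>s \<longleftrightarrow>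
     (\<forall>\<alpha>. admissible_exponents \<alpha> \<longrightarrow>
        (\<forall>\<epsilon>>0. \<forall>k0\<ge>0. \<exists>(M::real) (N::nat). \<forall>n\<ge>1. real N \<le> \<alpha> n * real n \<longrightarrow>
           outer_prob (P n)
             (\<lambda>x. ennreal M < (\<integral>\<^sup>+\<theta>. ennreal
                 (norm (sqrt (\<alpha> n * real n) *\<^sub>R (\<theta> - \<theta>s)) powr k0
                   * alpha_posterior \<Theta> f \<pi> n (\<alpha> n) x \<theta>) \<partial>lborel))
             < ennreal \<epsilon>))"

text \<open>
  In the next two conditions the bounds are imposed at parameters of the model only, that is, at
  points of the indicated regions that lie in the parameter space.
\<close>

definition condition_1 ::
  "(nat \<Rightarrow> 'd sample measure) \<Rightarrow> (real ^ 'p) set \<Rightarrow> ('d, 'p) model \<Rightarrow> real ^ 'p \<Rightarrow>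
    real \<Rightarrow> real \<Rightarrow> real \<Rightarrow> real \<Rightarrow> real \<Rightarrow> (real \<Rightarrow> real) \<Rightarrow> bool" where
  "condition_1 P \<Theta> f \<theta>s L c0 c1 c2 r \<gamma> \<longleftrightarrow>
     0 < L \<and> 0 < c0 \<and> 0 < c1 \<and> 0 \<le> c2 \<and> exp (c2 / c0) / c1 < r \<and>
     (\<forall>v\<ge>0. 0 \<le> \<gamma> v) \<and>
     (\<forall>v\<ge>r. c0 * ln (1 + c1 * v) - c2 \<le> \<gamma> v) \<and>
     with_prob_tending_to_one P
       (\<lambda>n x. \<forall>\<theta>\<in>\<Theta> - ball \<theta>s r.
          loglik_ratio f n x \<theta> \<theta>s \<le> ereal (- L * real n * \<gamma> (norm (\<theta> - \<theta>s))))"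

definition condition_2 ::
  "(nat \<Rightarrow> 'd sample measure) \<Rightarrow> (real ^ 'p) set \<Rightarrow> ('d, 'p) model \<Rightarrow>
    (nat \<Rightarrow> 'd sample \<Rightarrow> real ^ 'p) \<Rightarrow> real \<Rightarrow> bool" where
  "condition_2 P \<Theta> f \<theta>hat r \<longleftrightarrow>
     (\<exists>c3>0. \<exists>c4>0. with_prob_tending_to_one P
       (\<lambda>n x. \<forall>\<theta>\<in>\<Theta> \<inter> ball (\<theta>hat n x) (2 * r).
          ereal (- real n * c3 * (norm (\<theta> - \<theta>hat n x))\<^sup>2) \<le> loglik_ratio f n x \<theta> (\<theta>hat n x) \<and>
          loglik_ratio f n x \<theta> (\<theta>hat n x) \<le> ereal (- real n * c4 * (norm (\<theta> - \<theta>hat n x))\<^sup>2)))"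

end

theory Submission
  imports Defs
begin

text \<open>
  Randomness enters only through the probability that a few estimates hold, so the heart of the
  matter is a statement about a sequence of fixed samples. On a set of samples of probability
  tending to one, the MLE is within \<open>\<eta>\<close> of the true parameter, \<open>\<alpha>hat\<^sub>n / \<alpha>\<^sub>n\<close> within \<open>\<eta>\<close> of \<open>1\<close>,
  \<open>sqrt (\<alpha>\<^sub>n n) (\<theta>hat - \<theta>s)\<close> has norm at most \<open>\<eta>\<close>, the remainder of the
  quadratic expansion is at most \<open>\<eta>\<close> on the ball of radius \<open>1 / \<eta>\<close>, and the two likelihood bounds
  hold. If for some \<open>\<epsilon>\<close> no \<open>\<eta>\<close> forced the total variation distance below \<open>\<epsilon>\<close> for all large \<open>n\<close>,
  there would be samples, with \<open>n\<close> tending to infinity and \<open>\<eta>\<close> to \<open>0\<close>, along which the distance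
  stays above \<open>\<epsilon>\<close> (\<open>tendsto_in_prob_by_sequences\<close>). Hence it suffices to treat one such sequence,
  where dominated convergence is available (\<open>posterior_TV_limit\<close>).

  Fix such a sequence and put \<open>\<theta> = \<theta>hat + h / s\<close> with \<open>s\<^sup>2 = \<alpha>\<^sub>n n\<close>. Total variation is invariant under
  this substitution, the normal density becomes the fixed one with precision matrix \<open>V\<close>, and the
  posterior becomes proportional to \<open>(f(\<theta>hat + h / s) / f(\<theta>hat)) ^ \<alpha>hat * \<pi>(\<theta>hat + h / s)\<close>.

  Pointwise limit: the quadratic expansion is centred at the true parameter, but evaluated at
  \<open>h + u\<close> and at \<open>u\<close>, where \<open>u = s (\<theta>hat - \<theta>s)\<close>, the linear terms cancel and the exponent is
  \<open>- h \<bullet> V h / 2\<close> up to twice the remainder (\<open>local_quadratic_at_MLE\<close>). Here \<open>u\<close> is small because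
  \<open>u = sqrt \<alpha>\<^sub>n * (sqrt n (\<theta>hat - \<theta>s))\<close>, a null sequence times a tight one.

  Domination: near the MLE the quadratic upper bound gives a Gaussian bound in \<open>h\<close>. Far from the
  true parameter the logarithmic growth of \<open>\<gamma>\<close>, multiplied by \<open>\<alpha>hat n\<close>, gives polynomial decay of an
  order that tends to infinity, together with a factor exponentially small in \<open>s\<^sup>2\<close> that absorbs the
  powers of \<open>s\<close> coming from the rescaling. Both are bounded by a multiple of the integrable function
  \<open>\<Prod>\<^sub>b 1 / (1 + (h \<bullet> b)\<^sup>2)\<close> (\<open>likelihood_ratio_dominated\<close>).

  Dominated convergence gives convergence of the unnormalised densities and of their integrals, hence
  of the normalised densities in \<open>L\<^sup>1\<close> (\<open>normalized_L1_limit\<close>). That the limit is the normal density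
  and not just a multiple of it uses the value of the Gaussian integral (\<open>gaussian_nn_integral\<close>).
\<close>

section \<open>Linear change of variables for Lebesgue measure\<close>

lemma nn_integral_lborel_diagonal_matrix:
  fixes A :: "real ^ 'n ^ 'n" and \<phi> :: "real ^ 'n \<Rightarrow> ennreal"
  assumes diag: "\<And>i j. i \<noteq> j \<Longrightarrow> A $ i $ j = 0" and det: "det A \<noteq> 0"
    and [measurable]: "\<phi> \<in> borel_measurable borel"
  shows "(\<integral>\<^sup>+x. \<phi> x \<partial>lborel) = ennreal \<bar>det A\<bar> * (\<integral>\<^sup>+x. \<phi> (A *v x) \<partial>lborel)"
proof -
  define c where "c b = (A *v b) \<bullet> b" for b
  have detA: "det A = (\<Prod>i\<in>UNIV. A $ i $ i)"
    using diag by (rule det_diagonal)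
  have c_axis: "c (axis i 1) = A $ i $ i" for i
    by (simp add: c_def inner_axis matrix_vector_mul_component)
  have nz: "c b \<noteq> 0" if "b \<in> Basis" for b
  proof -
    from that obtain i where "b = axis i 1" by (auto simp: Basis_vec_def)
    moreover have "A $ i $ i \<noteq> 0" using det unfolding detA by simp
    ultimately show ?thesis using c_axis by simp
  qed
  have T: "(\<lambda>x. 0 + (\<Sum>j\<in>Basis. (c j * (x \<bullet> j)) *\<^sub>R j)) = (*v) A"
  proof
    fix x
    have "A $ i $ i * x $ i = (A *v x) $ i" for i
    proof -
      have "(A *v x) $ i = (\<Sum>j\<in>UNIV. A $ i $ j * x $ j)" by (simp add: matrix_vector_mult_def)
      also have "\<dots> = (\<Sum>j\<in>{i}. A $ i $ j * x $ j)"
        by (rule sum.mono_neutral_right) (use diag in auto)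
      finally show ?thesis by simp
    qed
    then have "(A *v x) \<bullet> b = c b * (x \<bullet> b)" if "b \<in> Basis" for b
      using that by (auto simp: Basis_vec_def c_axis inner_axis)
    then show "0 + (\<Sum>j\<in>Basis. (c j * (x \<bullet> j)) *\<^sub>R j) = A *v x"
      by (subst euclidean_representation[symmetric, of "A *v x"]) simp
  qed
  have prod: "(\<Prod>b\<in>Basis. \<bar>c b\<bar>) = \<bar>det A\<bar>"
  proof -
    have B: "(Basis :: (real ^ 'n) set) = (\<lambda>i. axis i 1) ` UNIV" by (auto simp: Basis_vec_def)
    have "inj (\<lambda>i::'n. axis i (1::real))" by (auto simp: inj_on_def axis_eq_axis)
    then show ?thesis
      unfolding B detA by (subst prod.reindex) (auto simp: c_axis abs_prod)
  qed
  have L: "lborel = density (distr lborel borel ((*v) A)) (\<lambda>_. ennreal \<bar>det A\<bar>)"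
    using lborel_affine_euclidean[of c 0, OF nz] unfolding T prod .
  have [measurable]: "(*v) A \<in> borel_measurable borel"
    by (intro borel_measurable_continuous_onI) (simp add: linear_continuous_on matrix_vector_mul_bounded_linear)
  show ?thesis
    by (subst L) (simp add: nn_integral_density nn_integral_distr nn_integral_cmult)
qed

lemma nn_integral_lborel_swap_coordinates:
  fixes m n :: "'n::finite" and \<phi> :: "real ^ 'n \<Rightarrow> ennreal"
  assumes [measurable]: "\<phi> \<in> borel_measurable borel"
  shows "(\<integral>\<^sup>+x. \<phi> (\<chi> i. x $ Transposition.transpose m n i) \<partial>lborel) = (\<integral>\<^sup>+x. \<phi> x \<partial>lborel)"
proof -
  let ?t = "Transposition.transpose m n"
  let ?S = "\<lambda>x :: real ^ 'n. \<chi> i. x $ ?t i"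
  have [measurable]: "?S \<in> borel_measurable borel"
    by (intro borel_measurable_continuous_onI continuous_intros)
  have B: "(Basis :: (real ^ 'n) set) = (\<lambda>i. axis i 1) ` UNIV" by (auto simp: Basis_vec_def)
  have "inj (\<lambda>i::'n. axis i (1::real))" by (auto simp: inj_on_def axis_eq_axis)
  then have prodB: "(\<Prod>b\<in>Basis. z \<bullet> b) = (\<Prod>i\<in>UNIV. z $ i)" for z :: "real ^ 'n"
    unfolding B by (subst prod.reindex) (auto simp: inner_axis)
  have "lborel = distr lborel borel ?S"
  proof (rule lborel_eqI)
    fix l u :: "real ^ 'n" assume le: "\<And>b. b \<in> Basis \<Longrightarrow> l \<bullet> b \<le> u \<bullet> b"
    then have le': "l $ i \<le> u $ i" for i
      by (metis cart_eq_inner_axis axis_in_Basis_iff Basis_real_def insertI1)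
    have "?S -` box l u = box (?S l) (?S u)"
    proof -
      have "(\<forall>i. l $ i < x $ ?t i \<and> x $ ?t i < u $ i) \<longleftrightarrow>
        (\<forall>i. l $ ?t i < x $ i \<and> x $ i < u $ ?t i)" for x
        by (metis transpose_involutory)
      then show ?thesis by (auto simp: mem_box_cart)
    qed
    then have "emeasure (distr lborel borel ?S) (box l u) = emeasure lborel (box (?S l) (?S u))"
      by (subst emeasure_distr) auto
    also have "\<dots> = (\<Prod>b\<in>Basis. (?S u - ?S l) \<bullet> b)"
      by (subst emeasure_lborel_box) (auto simp: B inner_axis le')
    also have "\<dots> = (\<Prod>i\<in>UNIV. (u - l) $ ?t i)"
      by (subst prodB) simp
    also have "\<dots> = (\<Prod>i\<in>UNIV. (u - l) $ i)"
      by (intro arg_cong[where f=ennreal] prod.reindex_bij_betw) simp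
    finally show "emeasure (distr lborel borel ?S) (box l u) = (\<Prod>b\<in>Basis. (u - l) \<bullet> b)"
      by (simp only: prodB)
  qed simp
  then have "(\<integral>\<^sup>+x. \<phi> x \<partial>lborel) = (\<integral>\<^sup>+x. \<phi> x \<partial>distr lborel borel ?S)" by simp
  then show ?thesis by (simp add: nn_integral_distr)
qed

text \<open>
  With the \<open>a\<close>-coordinate integrated innermost, the shear is a translation of that coordinate by a
  quantity that the inner integral sees as a constant.
\<close>

lemma nn_integral_lborel_shear:
  fixes a b :: "'a::euclidean_space" and \<phi> :: "'a \<Rightarrow> ennreal"
  assumes a: "a \<in> Basis" and b: "b \<in> Basis" and ab: "a \<noteq> b"
    and [measurable]: "\<phi> \<in> borel_measurable borel"
  shows "(\<integral>\<^sup>+x. \<phi> (x + (x \<bullet> b) *\<^sub>R a) \<partial>lborel) = (\<integral>\<^sup>+x. \<phi> x \<partial>lborel)"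
proof -
  let ?I = "Basis - {a}"
  let ?v = "\<lambda>f. \<Sum>c\<in>Basis. f c *\<^sub>R c :: 'a"
  interpret product_sigma_finite "\<lambda>_::'a. lborel :: real measure" ..
  have I: "(Basis :: 'a set) = insert a ?I" using a by auto
  have fubini: "(\<integral>\<^sup>+x. \<psi> x \<partial>lborel) =
      (\<integral>\<^sup>+f. (\<integral>\<^sup>+y. \<psi> (?v (f(a := y))) \<partial>lborel) \<partial>Pi\<^sub>M ?I (\<lambda>_. lborel))"
    if [measurable]: "\<psi> \<in> borel_measurable borel" for \<psi> :: "'a \<Rightarrow> ennreal"
  proof -
    have "(\<integral>\<^sup>+x. \<psi> x \<partial>lborel) = (\<integral>\<^sup>+f. \<psi> (?v f) \<partial>Pi\<^sub>M Basis (\<lambda>_. lborel))"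
      by (subst lborel_eq) (simp add: nn_integral_distr)
    also have "\<dots> = (\<integral>\<^sup>+f. \<psi> (?v f) \<partial>Pi\<^sub>M (insert a ?I) (\<lambda>_. lborel))"
      using I by simp
    also have "\<dots> = (\<integral>\<^sup>+f. (\<integral>\<^sup>+y. \<psi> (?v (f(a := y))) \<partial>lborel) \<partial>Pi\<^sub>M ?I (\<lambda>_. lborel))"
      by (rule product_nn_integral_insert) (auto simp: I[symmetric])
    finally show ?thesis .
  qed
  have eq: "?v (f(a := y)) + (?v (f(a := y)) \<bullet> b) *\<^sub>R a = ?v (f(a := f b + 1 * y))" for f y
  proof (rule euclidean_eqI)
    fix c :: 'a assume c: "c \<in> Basis"
    show "(?v (f(a := y)) + (?v (f(a := y)) \<bullet> b) *\<^sub>R a) \<bullet> c = ?v (f(a := f b + 1 * y)) \<bullet> c"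
      using a b ab c by (auto simp: inner_add_left inner_Basis)
  qed
  have "(\<integral>\<^sup>+x. \<phi> (x + (x \<bullet> b) *\<^sub>R a) \<partial>lborel) =
      (\<integral>\<^sup>+f. (\<integral>\<^sup>+y. \<phi> (?v (f(a := f b + 1 * y))) \<partial>lborel) \<partial>Pi\<^sub>M ?I (\<lambda>_. lborel))"
    by (subst fubini) (simp_all only: eq, measurable)
  also have "\<dots> = (\<integral>\<^sup>+f. (\<integral>\<^sup>+y. \<phi> (?v (f(a := y))) \<partial>lborel) \<partial>Pi\<^sub>M ?I (\<lambda>_. lborel))"
  proof (rule nn_integral_cong)
    fix f
    have "continuous_on UNIV (\<lambda>y. ?v (f(a := y)))"
    proof (intro continuous_intros)
      fix c :: 'a assume "c \<in> Basis"
      show "continuous_on UNIV (\<lambda>y. (f(a := y)) c)" by (cases "c = a") (auto intro: continuous_intros)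
    qed
    then have "(\<lambda>y. \<phi> (?v (f(a := y)))) \<in> borel_measurable borel"
      by (intro measurable_compose[OF borel_measurable_continuous_onI assms(4)])
    then have "(\<integral>\<^sup>+y. \<phi> (?v (f(a := y))) \<partial>lborel) =
        ennreal \<bar>1\<bar> * (\<integral>\<^sup>+y. \<phi> (?v (f(a := f b + 1 * y))) \<partial>lborel)"
      by (rule nn_integral_real_affine[where f="\<lambda>y. \<phi> (?v (f(a := y)))"]) simp
    then show "(\<integral>\<^sup>+y. \<phi> (?v (f(a := f b + 1 * y))) \<partial>lborel) = (\<integral>\<^sup>+y. \<phi> (?v (f(a := y))) \<partial>lborel)"
      by simp
  qed
  also have "\<dots> = (\<integral>\<^sup>+x. \<phi> x \<partial>lborel)"
    by (subst fubini) auto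
  finally show ?thesis .
qed

text \<open>
  Both sides are multiplicative in the matrix, so products of diagonal matrices, coordinate swaps and
  shears suffice. A matrix with a zero row is excluded by its determinant.
\<close>

lemma nn_integral_lborel_linear_change:
  fixes A :: "real ^ 'n ^ 'n" and \<phi> :: "real ^ 'n \<Rightarrow> ennreal"
  assumes "det A \<noteq> 0" and "\<phi> \<in> borel_measurable borel"
  shows "(\<integral>\<^sup>+x. \<phi> x \<partial>lborel) = ennreal \<bar>det A\<bar> * (\<integral>\<^sup>+x. \<phi> (A *v x) \<partial>lborel)"
proof -
  let ?P = "\<lambda>A :: real ^ 'n ^ 'n. \<forall>\<phi> :: real ^ 'n \<Rightarrow> ennreal. \<phi> \<in> borel_measurable borel \<longrightarrow> det A \<noteq> 0 \<longrightarrow>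
    (\<integral>\<^sup>+x. \<phi> x \<partial>lborel) = ennreal \<bar>det A\<bar> * (\<integral>\<^sup>+x. \<phi> (A *v x) \<partial>lborel)"
  have "?P A"
  proof (induction A rule: induct_matrix_elementary_alt)
    case (1 A B)
    have meas: "(*v) A \<in> borel_measurable borel"
      by (intro borel_measurable_continuous_onI) (simp add: linear_continuous_on matrix_vector_mul_bounded_linear)
    show ?case
    proof safe
      fix \<phi> :: "real ^ 'n \<Rightarrow> ennreal" assume [measurable]: "\<phi> \<in> borel_measurable borel"
        and "det (A ** B) \<noteq> 0"
      then have "det A \<noteq> 0" "det B \<noteq> 0" by (auto simp: det_mul)
      then have "(\<integral>\<^sup>+x. \<phi> x \<partial>lborel) = ennreal \<bar>det A\<bar> * (\<integral>\<^sup>+x. \<phi> (A *v x) \<partial>lborel)"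
        "(\<integral>\<^sup>+x. \<phi> (A *v x) \<partial>lborel) = ennreal \<bar>det B\<bar> * (\<integral>\<^sup>+x. \<phi> (A *v (B *v x)) \<partial>lborel)"
        using "1"(1)[rule_format, of \<phi>] "1"(2)[rule_format, of "\<lambda>x. \<phi> (A *v x)"]
          measurable_compose[OF meas, of \<phi> borel] by simp_all
      then show "(\<integral>\<^sup>+x. \<phi> x \<partial>lborel) = ennreal \<bar>det (A ** B)\<bar> * (\<integral>\<^sup>+x. \<phi> ((A ** B) *v x) \<partial>lborel)"
        by (simp add: det_mul abs_mult ennreal_mult mult.assoc matrix_vector_mul_assoc)
    qed
  next
    case (2 A i)
    then show ?case by (auto simp: det_zero_row row_def)
  next
    case (3 A)
    then show ?case using nn_integral_lborel_diagonal_matrix by blast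
  next
    case (4 m n)
    let ?S = "\<chi> i j. mat 1 $ i $ Transposition.transpose m n j :: real ^ 'n ^ 'n"
    have *: "?S *v x = (\<chi> i. x $ Transposition.transpose m n i)" for x
    proof -
      have "(\<Sum>j\<in>UNIV. ?S $ i $ j * x $ j) = x $ Transposition.transpose m n i" for i
      proof -
        have "?S $ i $ j = (if j = Transposition.transpose m n i then 1 else 0)" for j
          by (auto simp: mat_def)
        then show ?thesis by (simp add: if_distrib[of "\<lambda>u. u * _"] cong: if_cong)
      qed
      then show ?thesis by (simp add: matrix_vector_mult_def)
    qed
    have "det ?S = of_int (sign (Transposition.transpose m n)) * det (mat 1 :: real ^ 'n ^ 'n)"
      by (rule det_permute_columns) (simp add: permutes_swap_id)
    then have "\<bar>det ?S\<bar> = 1" by (simp add: sign_def)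
    then show ?case by (simp add: * nn_integral_lborel_swap_coordinates)
  next
    case (5 m n)
    let ?S = "\<chi> i j. of_bool (i = m \<and> j = n \<or> i = j) :: real ^ 'n ^ 'n"
    have *: "?S *v x = x + (x \<bullet> axis n 1) *\<^sub>R axis m 1" for x
    proof -
      have "(\<Sum>j\<in>UNIV. ?S $ i $ j * x $ j) = x $ i + (if i = m then x $ n else 0)" for i
      proof -
        have "?S $ i $ j * x $ j = (if j = i then x $ i else 0) + (if j = n then (if i = m then x $ n else 0) else 0)" for j
          using 5 by auto
        then show ?thesis by (simp add: sum.distrib)
      qed
      moreover have "x \<bullet> axis n 1 = x $ n" by (simp add: inner_axis)
      ultimately show ?thesis by (simp add: matrix_vector_mult_def vec_eq_iff axis_def)
    qed
    have "?S = (\<chi> k. if k = m then row m (mat 1) + 1 *s row n (mat 1) else row k (mat 1))"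
      using 5 by (auto simp: vec_eq_iff row_def mat_def)
    then have "det ?S = det (mat 1 :: real ^ 'n ^ 'n)"
      using det_row_operation[OF 5, of "mat 1" 1] by simp
    then have det: "\<bar>det ?S\<bar> = 1" by simp
    have "(axis m 1 :: real ^ 'n) \<noteq> axis n 1" using 5 by (simp add: axis_eq_axis)
    then show ?case
      unfolding * det by (auto simp: nn_integral_lborel_shear)
  qed
  with assms show ?thesis by blast
qed

section \<open>The Gaussian integral\<close>

text \<open>
  Gram--Schmidt for the inner product given by \<open>V\<close>: as long as there are fewer than \<open>p\<close> vectors
  \<open>v i\<close>, some nonzero \<open>w\<close> is orthogonal to all \<open>V *v v i\<close>, and it can be normalised. The columns of
  \<open>B\<close> are the resulting basis.
\<close>

lemma pos_def_matrix_congruent_identity: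
  fixes V :: "real ^ 'p ^ 'p"
  assumes V: "pos_def_matrix V"
  obtains B :: "real ^ 'p ^ 'p" where "transpose B ** V ** B = mat 1"
proof -
  have sym: "x \<bullet> (V *v y) = y \<bullet> (V *v x)" for x y
    using V by (metis dot_lmul_matrix inner_commute pos_def_matrix_def transpose_matrix_vector)
  have "\<exists>v. \<forall>i\<in>S. \<forall>j\<in>S. v i \<bullet> (V *v v j) = (if i = j then 1 else 0)" if "finite S" for S :: "'p set"
    using that
  proof (induction S)
    case (insert k S)
    then obtain v where v: "\<And>i j. i \<in> S \<Longrightarrow> j \<in> S \<Longrightarrow> v i \<bullet> (V *v v j) = (if i = j then 1 else 0)"
      by blast
    let ?W = "(\<lambda>i. V *v v i) ` S"
    have "dim ?W \<le> card ?W"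
      using insert.hyps by (intro dim_le_card') simp
    also have "\<dots> \<le> card S" using insert.hyps by (intro card_image_le)
    also have "\<dots> < card (insert k S)" using insert.hyps by simp
    also have "\<dots> \<le> CARD('p)" by (intro card_mono) auto
    finally have "dim ?W < DIM(real ^ 'p)" by simp
    then obtain w where w: "w \<noteq> 0" "\<And>y. y \<in> span ?W \<Longrightarrow> orthogonal w y"
      by (rule orthogonal_to_subspace_exists) blast
    have ws: "w \<bullet> (V *v v i) = 0" if "i \<in> S" for i
      using w(2)[of "V *v v i"] that by (auto simp: orthogonal_def span_base)
    define c where "c = w \<bullet> (V *v w)"
    have c: "c > 0" using V w(1) by (auto simp: c_def pos_def_matrix_def)
    define u where "u = (1 / sqrt c) *\<^sub>R w"
    have uu: "u \<bullet> (V *v u) = 1"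
      using c by (simp add: u_def matrix_vector_mult_scaleR c_def[symmetric] real_sqrt_mult_self)
    have us: "u \<bullet> (V *v v i) = 0" "v i \<bullet> (V *v u) = 0" if "i \<in> S" for i
      using ws[OF that] sym[of "v i" u] by (auto simp: u_def)
    show ?case
      by (rule exI[of _ "v(k := u)"]) (use insert.hyps v uu us in \<open>auto split: if_splits\<close>)
  qed simp
  from this[OF finite_class.finite_UNIV] obtain v :: "'p \<Rightarrow> real ^ 'p" where
    v: "\<And>i j. v i \<bullet> (V *v v j) = (if i = j then 1 else 0)" by auto
  let ?B = "\<chi> i j. v j $ i"
  have "(transpose ?B ** V ** ?B) $ i $ j = v i \<bullet> (V *v v j)" for i j
  proof -
    have "(transpose ?B ** (V ** ?B)) $ i $ j = v i \<bullet> (V *v v j)"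
      by (simp add: matrix_matrix_mult_def matrix_vector_mult_def transpose_def inner_vec_def)
    then show ?thesis by (simp add: matrix_mul_assoc)
  qed
  then have "transpose ?B ** V ** ?B = mat 1"
    by (simp add: vec_eq_iff v mat_def)
  then show thesis by (rule that)
qed

lemma matrix_inv_eqI:
  fixes A B :: "real ^ 'n ^ 'n"
  assumes "A ** B = mat 1"
  shows "matrix_inv A = B"
proof -
  have BA: "B ** A = mat 1" using assms matrix_left_right_inverse by blast
  then have "A ** matrix_inv A = mat 1 \<and> matrix_inv A ** A = mat 1"
    unfolding matrix_inv_def using assms by (rule_tac someI[of _ B]) simp
  then have "B ** (A ** matrix_inv A) = B" by (simp only: matrix_mul_rid)
  moreover have "B ** (A ** matrix_inv A) = matrix_inv A"
    unfolding matrix_mul_assoc BA by (rule matrix_mul_lid)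
  ultimately show ?thesis by simp
qed

lemma det_scaleR_matrix: "det (c *\<^sub>R A) = c ^ CARD('n) * det A" for A :: "real ^ 'n ^ 'n"
proof -
  have "det (c *\<^sub>R A) = det (\<chi> i. c *s A $ i)"
    by (rule arg_cong[where f=det]) (simp add: vec_eq_iff)
  also have "\<dots> = c ^ CARD('n) * det A"
    by (subst det_rows_mul) simp
  finally show ?thesis .
qed

text \<open>
  In the coordinates \<open>h = B *v z\<close> of a basis orthonormal for \<open>V\<close>, the quadratic form is \<open>z \<bullet> z\<close>, so the
  integral splits into one-dimensional ones. The Jacobian \<open>\<bar>det B\<bar>\<close> is the square root of the
  determinant of \<open>matrix_inv V\<close>, because \<open>matrix_inv V = B ** transpose B\<close>.
\<close>

lemma pos_def_matrix_inverse:
  fixes V :: "real ^ 'p ^ 'p"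
  assumes V: "pos_def_matrix V"
  shows "matrix_inv V ** V = mat 1" "det (matrix_inv V) > 0"
    and gaussian_nn_integral: "(\<integral>\<^sup>+h. ennreal (exp (- (1/2) * (h \<bullet> (V *v h)))) \<partial>lborel) =
      ennreal (sqrt ((2 * pi) ^ CARD('p) * det (matrix_inv V)))"
proof -
  obtain B :: "real ^ 'p ^ 'p" where B: "transpose B ** V ** B = mat 1"
    using pos_def_matrix_congruent_identity[OF V] .
  have "det (transpose B ** V ** B) = 1" by (simp add: B)
  then have dB: "det V * (det B)\<^sup>2 = 1" by (simp add: det_mul power2_eq_square mult_ac)
  then have dB0: "det B \<noteq> 0" by auto
  have inv: "B ** (transpose B ** V) = mat 1"
    using B matrix_left_right_inverse by blast
  then have "(B ** transpose B) ** V = mat 1" by (simp add: matrix_mul_assoc)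
  then have 1: "V ** (B ** transpose B) = mat 1" using matrix_left_right_inverse by blast
  then have iV: "matrix_inv V = B ** transpose B" by (rule matrix_inv_eqI)
  then show "matrix_inv V ** V = mat 1"
    using 1 matrix_left_right_inverse by auto
  have det_inv: "det (matrix_inv V) = (det B)\<^sup>2"
    by (simp add: iV det_mul power2_eq_square)
  then show "det (matrix_inv V) > 0" using dB0 by simp
  have quad: "(B *v z) \<bullet> (V *v (B *v z)) = z \<bullet> z" for z
  proof -
    have "(B *v z) \<bullet> (V *v (B *v z)) = z \<bullet> ((transpose B ** V ** B) *v z)"
      unfolding matrix_vector_mul_assoc[symmetric]
      by (metis dot_lmul_matrix transpose_matrix_vector transpose_transpose inner_commute)
    then show ?thesis by (simp add: B)
  qed
  have meas: "(\<lambda>h. ennreal (exp (- (1/2) * (h \<bullet> (V *v h))))) \<in> borel_measurable borel"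
  proof -
    have "continuous_on UNIV (\<lambda>h. exp (- (1/2) * (h \<bullet> (V *v h))))"
      by (intro continuous_intros linear_continuous_on matrix_vector_mul_bounded_linear)
    then have "(\<lambda>h. exp (- (1/2) * (h \<bullet> (V *v h)))) \<in> borel_measurable borel"
      by (rule borel_measurable_continuous_onI)
    then show ?thesis by measurable
  qed
  have one: "(\<integral>\<^sup>+x. ennreal (exp (- (1/2) * x\<^sup>2)) \<partial>lborel) = ennreal (sqrt (2 * pi))"
  proof -
    have "(\<integral>\<^sup>+x. ennreal (exp (- (1/2) * x\<^sup>2)) \<partial>lborel) =
        (\<integral>\<^sup>+x. ennreal (sqrt (2 * pi)) * ennreal (std_normal_density x) \<partial>lborel)"
      by (intro nn_integral_cong) (simp add: std_normal_density_def ennreal_mult[symmetric])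
    also have "\<dots> = ennreal (sqrt (2 * pi)) * (\<integral>\<^sup>+x. ennreal (std_normal_density x) \<partial>lborel)"
      by (rule nn_integral_cmult) simp
    also have "(\<integral>\<^sup>+x. ennreal (std_normal_density x) \<partial>lborel) = 1"
      by (subst nn_integral_eq_integral) (auto simp: normal_density_nonneg)
    finally show ?thesis by simp
  qed
  have "(\<integral>\<^sup>+h. ennreal (exp (- (1/2) * (h \<bullet> (V *v h)))) \<partial>lborel) =
      ennreal \<bar>det B\<bar> * (\<integral>\<^sup>+(z::real ^ 'p). ennreal (exp (- (1/2) * (z \<bullet> z))) \<partial>lborel)"
    using nn_integral_lborel_linear_change[OF dB0 meas] by (simp add: quad)
  also have "(\<integral>\<^sup>+(z::real ^ 'p). ennreal (exp (- (1/2) * (z \<bullet> z))) \<partial>lborel) =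
      (\<integral>\<^sup>+(z::real ^ 'p). (\<Prod>b\<in>Basis. ennreal (exp (- (1/2) * (z \<bullet> b)\<^sup>2))) \<partial>lborel)"
  proof (rule nn_integral_cong)
    fix z :: "real ^ 'p"
    have "z \<bullet> z = (\<Sum>b\<in>Basis. (z \<bullet> b)\<^sup>2)"
      by (subst euclidean_inner) (simp add: power2_eq_square)
    then have "- (1/2) * (z \<bullet> z) = (\<Sum>b\<in>Basis. - (1/2) * (z \<bullet> b)\<^sup>2)" by (simp only: sum_distrib_left)
    then show "ennreal (exp (- (1/2) * (z \<bullet> z))) = (\<Prod>b\<in>Basis. ennreal (exp (- (1/2) * (z \<bullet> b)\<^sup>2)))"
      by (simp only: exp_sum finite_Basis prod_ennreal exp_ge_zero)
  qed
  also have "\<dots> = ennreal (sqrt (2 * pi)) ^ CARD('p)"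
    by (subst nn_integral_lborel_prod) (simp_all only: one prod_constant, simp_all)
  also have "ennreal \<bar>det B\<bar> * \<dots> = ennreal (sqrt ((2 * pi) ^ CARD('p) * det (matrix_inv V)))"
  proof -
    have "sqrt ((2 * pi) ^ CARD('p) * (det B)\<^sup>2) = \<bar>det B\<bar> * sqrt (2 * pi) ^ CARD('p)"
      unfolding real_sqrt_mult real_sqrt_abs by (simp add: real_sqrt_power real_sqrt_mult power_mult_distrib)
    then show ?thesis
      by (simp only: det_inv ennreal_power ennreal_mult[symmetric] abs_ge_zero zero_le_power
          real_sqrt_ge_zero pi_ge_zero mult_nonneg_nonneg zero_le_numeral)
  qed
  finally show "(\<integral>\<^sup>+h. ennreal (exp (- (1/2) * (h \<bullet> (V *v h)))) \<partial>lborel) =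
      ennreal (sqrt ((2 * pi) ^ CARD('p) * det (matrix_inv V)))" .
qed

text \<open>
  Blowing up by \<open>s\<close> around the mean turns the shrinking normal density into a fixed one; the factor
  \<open>s ^ CARD('p)\<close> is the Jacobian that \<open>lborel_integral_affine\<close> removes again.
\<close>

lemma mvn_density_rescaled:
  fixes V :: "real ^ 'p ^ 'p"
  assumes V: "pos_def_matrix V" and s: "s > 0"
  shows "mvn_density t ((1 / s\<^sup>2) *\<^sub>R matrix_inv V) (t + (1 / s) *\<^sub>R h) =
    s ^ CARD('p) * (exp (- (1/2) * (h \<bullet> (V *v h))) / sqrt ((2 * pi) ^ CARD('p) * det (matrix_inv V)))"
proof -
  have "((1 / s\<^sup>2) *\<^sub>R matrix_inv V) ** (s\<^sup>2 *\<^sub>R V) = mat 1"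
    using s pos_def_matrix_inverse(1)[OF V]
    by (simp add: scalar_matrix_assoc[symmetric] matrix_scalar_ac)
  then have inv: "matrix_inv ((1 / s\<^sup>2) *\<^sub>R matrix_inv V) = s\<^sup>2 *\<^sub>R V" by (rule matrix_inv_eqI)
  have quad: "((1 / s) *\<^sub>R h) \<bullet> ((s\<^sup>2 *\<^sub>R V) *v ((1 / s) *\<^sub>R h)) = h \<bullet> (V *v h)"
    using s by (simp add: scaleR_matrix_vector_assoc[symmetric] matrix_vector_mult_scaleR power2_eq_square)
  have "sqrt ((2 * pi) ^ CARD('p) * det ((1 / s\<^sup>2) *\<^sub>R matrix_inv V)) =
      sqrt ((2 * pi) ^ CARD('p) * det (matrix_inv V)) / s ^ CARD('p)"
  proof -
    have "(2 * pi) ^ CARD('p) * det ((1 / s\<^sup>2) *\<^sub>R matrix_inv V) =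
        ((2 * pi) ^ CARD('p) * det (matrix_inv V)) / (s ^ CARD('p))\<^sup>2"
      by (simp add: det_scaleR_matrix power_divide power_mult[symmetric] mult.commute)
    then show ?thesis using s by (simp add: real_sqrt_divide)
  qed
  then show ?thesis
    unfolding mvn_density_def add_diff_cancel_left' inv quad by simp
qed

section \<open>Total variation limits by dominated convergence\<close>

lemma lborel_integral_affine:
  fixes g :: "'a::euclidean_space \<Rightarrow> real"
  assumes [measurable]: "g \<in> borel_measurable borel" and c: "c \<noteq> 0"
  shows "(\<integral>x. g x \<partial>lborel) = \<bar>c\<bar> ^ DIM('a) * (\<integral>x. g (t + c *\<^sub>R x) \<partial>lborel)"
proof -
  have "lborel = density (distr lborel borel (\<lambda>x::'a. t + c *\<^sub>R x)) (\<lambda>_. ennreal (\<bar>c\<bar> ^ DIM('a)))"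
    using lborel_affine[OF c, of t] by (simp add: ennreal_power)
  then have "(\<integral>x. g x \<partial>lborel) =
      (\<integral>x. g x \<partial>density (distr lborel borel (\<lambda>x::'a. t + c *\<^sub>R x)) (\<lambda>_. ennreal (\<bar>c\<bar> ^ DIM('a))))"
    by simp
  then show ?thesis
    by (simp add: integral_density integral_distr)
qed

text \<open>
  Dominated convergence is applied twice: to the integrals, and, once these are bounded away from
  zero, to the normalised functions.
\<close>

lemma normalized_L1_limit:
  fixes g :: "nat \<Rightarrow> 'a \<Rightarrow> real"
  assumes meas: "\<And>k. g k \<in> borel_measurable M" "G \<in> borel_measurable M"
    and lim: "\<And>x. x \<in> space M \<Longrightarrow> (\<lambda>k. g k x) \<longlonglongrightarrow> G x"
    and dom: "\<forall>\<^sub>F k in sequentially. \<forall>x\<in>space M. \<bar>g k x\<bar> \<le> D x"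
    and D: "integrable M D" and pos: "(\<integral>x. G x \<partial>M) > 0"
  shows "(\<lambda>k. \<integral>x. \<bar>g k x / (\<integral>y. g k y \<partial>M) - G x / (\<integral>y. G y \<partial>M)\<bar> \<partial>M) \<longlonglongrightarrow> 0"
proof -
  let ?I = "\<integral>y. G y \<partial>M"
  let ?J = "\<lambda>k. \<integral>y. g k y \<partial>M"
  note meas[measurable]
  obtain N where N: "\<And>k x. k \<ge> N \<Longrightarrow> x \<in> space M \<Longrightarrow> \<bar>g k x\<bar> \<le> D x"
    using dom unfolding eventually_sequentially by blast
  have shifted: "AE x in M. (\<lambda>k. g (k + N) x) \<longlonglongrightarrow> G x" "\<And>k. AE x in M. norm (g (k + N) x) \<le> D x"
    using N by (auto intro!: AE_I2 LIMSEQ_ignore_initial_segment lim)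
  have G: "integrable M G"
    by (rule integrable_dominated_convergence[OF _ _ D shifted]) measurable
  have "(\<lambda>k. ?J (k + N)) \<longlonglongrightarrow> ?I"
    by (rule integral_dominated_convergence[OF _ _ D shifted]) measurable
  then have J: "?J \<longlonglongrightarrow> ?I" by (rule LIMSEQ_offset)
  then have "\<forall>\<^sub>F k in sequentially. ?J k > ?I / 2"
    using pos by (intro order_tendstoD(1)) auto
  then obtain N' where N': "\<And>k. k \<ge> N' \<Longrightarrow> ?J k > ?I / 2"
    unfolding eventually_sequentially by blast
  \<comment> \<open>The bounds hold only from some index on, whereas dominated convergence wants them for all.\<close>
  let ?n = "N + N'"
  have "(\<lambda>k. \<integral>x. \<bar>g (k + ?n) x / ?J (k + ?n) - G x / ?I\<bar> \<partial>M) \<longlonglongrightarrow> (\<integral>x. 0 \<partial>M)"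
  proof (rule integral_dominated_convergence[where w="\<lambda>x. D x / (?I / 2) + \<bar>G x\<bar> / ?I"])
    show "integrable M (\<lambda>x. D x / (?I / 2) + \<bar>G x\<bar> / ?I)"
      using D G by auto
    show "AE x in M. (\<lambda>k. \<bar>g (k + ?n) x / ?J (k + ?n) - G x / ?I\<bar>) \<longlonglongrightarrow> 0"
    proof (rule AE_I2)
      fix x assume x: "x \<in> space M"
      have "(\<lambda>k. \<bar>g k x / ?J k - G x / ?I\<bar>) \<longlonglongrightarrow> \<bar>G x / ?I - G x / ?I\<bar>"
        using pos by (intro tendsto_intros lim x J) auto
      then show "(\<lambda>k. \<bar>g (k + ?n) x / ?J (k + ?n) - G x / ?I\<bar>) \<longlonglongrightarrow> 0"
        by (intro LIMSEQ_ignore_initial_segment) simp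
    qed
    show "AE x in M. norm \<bar>g (k + ?n) x / ?J (k + ?n) - G x / ?I\<bar> \<le> D x / (?I / 2) + \<bar>G x\<bar> / ?I" for k
    proof (rule AE_I2)
      fix x assume x: "x \<in> space M"
      have "\<bar>g (k + ?n) x\<bar> \<le> D x" "?J (k + ?n) > ?I / 2" using N[OF _ x] N' by auto
      then have "\<bar>g (k + ?n) x\<bar> / ?J (k + ?n) \<le> D x / (?I / 2)"
        using pos by (intro frac_le) auto
      moreover have "\<bar>g (k + ?n) x / ?J (k + ?n)\<bar> = \<bar>g (k + ?n) x\<bar> / ?J (k + ?n)"
        using \<open>?J (k + ?n) > ?I / 2\<close> pos by (simp add: abs_div)
      moreover have "\<bar>G x / ?I\<bar> = \<bar>G x\<bar> / ?I" using pos by simp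
      ultimately show "norm \<bar>g (k + ?n) x / ?J (k + ?n) - G x / ?I\<bar> \<le> D x / (?I / 2) + \<bar>G x\<bar> / ?I"
        using abs_triangle_ineq4[of "g (k + ?n) x / ?J (k + ?n)" "G x / ?I"]
        unfolding real_norm_def abs_abs by linarith
    qed
  qed measurable
  then show ?thesis by (simp add: LIMSEQ_offset)
qed

lemma measurable_mvn_density: "mvn_density \<mu> \<Sigma> \<in> borel_measurable borel"
proof -
  have "continuous_on UNIV (\<lambda>\<theta>. matrix_inv \<Sigma> *v (\<theta> - \<mu>))"
    by (rule bounded_linear.continuous_on[OF matrix_vector_mul_bounded_linear]) (intro continuous_intros)
  then have "continuous_on UNIV (\<lambda>\<theta>. exp (- (1/2) * ((\<theta> - \<mu>) \<bullet> (matrix_inv \<Sigma> *v (\<theta> - \<mu>)))))"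
    by (intro continuous_intros)
  then have "(\<lambda>\<theta>. exp (- (1/2) * ((\<theta> - \<mu>) \<bullet> (matrix_inv \<Sigma> *v (\<theta> - \<mu>))))) \<in> borel_measurable borel"
    by (rule borel_measurable_continuous_onI)
  then show ?thesis
    unfolding mvn_density_def by (rule borel_measurable_divide) simp
qed

text \<open>
  The factors \<open>c k\<close> drop out on normalising. They are there because likelihoods converge only after
  division by their maxima.
\<close>

lemma d_TV_rescaled_limit:
  fixes q :: "nat \<Rightarrow> real ^ 'p \<Rightarrow> real"
  assumes V: "pos_def_matrix V" and s: "\<And>k. s k > 0" and c: "\<And>k. c k > 0" and C: "C > 0"
    and meas: "\<And>k. q k \<in> borel_measurable borel"
    and lim: "\<And>h. (\<lambda>k. q k (t k + (1 / s k) *\<^sub>R h) / c k) \<longlonglongrightarrow> C * exp (- (1/2) * (h \<bullet> (V *v h)))"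
    and dom: "\<forall>\<^sub>F k in sequentially. \<forall>h. \<bar>q k (t k + (1 / s k) *\<^sub>R h) / c k\<bar> \<le> D h"
    and D: "integrable lborel D"
  shows "(\<lambda>k. d_TV (\<lambda>\<theta>. q k \<theta> / (\<integral>\<theta>. q k \<theta> \<partial>lborel))
      (mvn_density (t k) ((1 / (s k)\<^sup>2) *\<^sub>R matrix_inv V))) \<longlonglongrightarrow> 0"
proof -
  let ?Z = "sqrt ((2 * pi) ^ CARD('p) * det (matrix_inv V))"
  let ?e = "\<lambda>h. exp (- (1/2) * (h \<bullet> (V *v h)))"
  let ?g = "\<lambda>k h. q k (t k + (1 / s k) *\<^sub>R h) / c k"
  note meas[measurable]
  have Z: "?Z > 0" using pos_def_matrix_inverse(2)[OF V] by simp
  have cont: "continuous_on UNIV ?e"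
    by (intro continuous_intros linear_continuous_on matrix_vector_mul_bounded_linear)
  have em[measurable]: "?e \<in> borel_measurable borel"
    by (rule borel_measurable_continuous_onI[OF cont])
  have int: "(\<integral>h. ?e h \<partial>lborel) = ?Z"
    using gaussian_nn_integral[OF V] Z em by (subst integral_eq_nn_integral) simp_all
  have L: "(\<lambda>k. \<integral>h. \<bar>?g k h / (\<integral>y. ?g k y \<partial>lborel) - C * ?e h / (\<integral>y. C * ?e y \<partial>lborel)\<bar> \<partial>lborel) \<longlonglongrightarrow> 0"
    by (rule normalized_L1_limit[OF _ _ _ _ D]) (use lim dom C Z int borel_measurable_times[OF borel_measurable_const em] in simp_all)
  have eq: "d_TV (\<lambda>\<theta>. q k \<theta> / (\<integral>\<theta>. q k \<theta> \<partial>lborel)) (mvn_density (t k) ((1 / (s k)\<^sup>2) *\<^sub>R matrix_inv V)) =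
      (1/2) * (\<integral>h. \<bar>?g k h / (\<integral>y. ?g k y \<partial>lborel) - C * ?e h / (\<integral>y. C * ?e y \<partial>lborel)\<bar> \<partial>lborel)" for k
  proof -
    let ?\<phi> = "mvn_density (t k) ((1 / (s k)\<^sup>2) *\<^sub>R matrix_inv V)"
    let ?p = "CARD('p)"
    have [measurable]: "?\<phi> \<in> borel_measurable borel"
      by (rule measurable_mvn_density)
    have sp: "s k ^ ?p > 0" using s by simp
    have Q: "(\<integral>\<theta>. q k \<theta> \<partial>lborel) = (1 / s k) ^ ?p * (\<integral>h. q k (t k + (1 / s k) *\<^sub>R h) \<partial>lborel)"
      using s[of k] by (subst lborel_integral_affine[of _ "1 / s k" "t k"]) auto
    have "(\<integral>\<theta>. \<bar>q k \<theta> / (\<integral>\<theta>. q k \<theta> \<partial>lborel) - ?\<phi> \<theta>\<bar> \<partial>lborel) =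
       (1 / s k) ^ ?p * (\<integral>h. \<bar>q k (t k + (1 / s k) *\<^sub>R h) / (\<integral>\<theta>. q k \<theta> \<partial>lborel)
          - ?\<phi> (t k + (1 / s k) *\<^sub>R h)\<bar> \<partial>lborel)"
      using s[of k] by (subst lborel_integral_affine[of _ "1 / s k" "t k"]) auto
    also have "\<dots> = (\<integral>h. (1 / s k) ^ ?p * \<bar>q k (t k + (1 / s k) *\<^sub>R h) / (\<integral>\<theta>. q k \<theta> \<partial>lborel)
          - ?\<phi> (t k + (1 / s k) *\<^sub>R h)\<bar> \<partial>lborel)"
      by simp
    also have "\<dots> = (\<integral>h. \<bar>?g k h / (\<integral>y. ?g k y \<partial>lborel) - C * ?e h / (\<integral>y. C * ?e y \<partial>lborel)\<bar> \<partial>lborel)"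
    proof (rule Bochner_Integration.integral_cong[OF refl])
      fix h
      have "(1 / s k) ^ ?p * \<bar>q k (t k + (1 / s k) *\<^sub>R h) / (\<integral>\<theta>. q k \<theta> \<partial>lborel)
          - ?\<phi> (t k + (1 / s k) *\<^sub>R h)\<bar> =
        \<bar>(1 / s k) ^ ?p * (q k (t k + (1 / s k) *\<^sub>R h) / (\<integral>\<theta>. q k \<theta> \<partial>lborel)
          - ?\<phi> (t k + (1 / s k) *\<^sub>R h))\<bar>"
        using s[of k] by (simp add: abs_mult)
      also have "(1 / s k) ^ ?p * (q k (t k + (1 / s k) *\<^sub>R h) / (\<integral>\<theta>. q k \<theta> \<partial>lborel)
          - ?\<phi> (t k + (1 / s k) *\<^sub>R h)) = ?g k h / (\<integral>y. ?g k y \<partial>lborel) - ?e h / ?Z"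
        using sp c[of k] s[of k] unfolding mvn_density_rescaled[OF V s] Q
        by (simp add: right_diff_distrib power_divide)
      also have "?e h / ?Z = C * ?e h / (\<integral>y. C * ?e y \<partial>lborel)"
        using C by (simp add: int[simplified])
      finally show "(1 / s k) ^ ?p * \<bar>q k (t k + (1 / s k) *\<^sub>R h) / (\<integral>\<theta>. q k \<theta> \<partial>lborel)
          - ?\<phi> (t k + (1 / s k) *\<^sub>R h)\<bar> = \<bar>?g k h / (\<integral>y. ?g k y \<partial>lborel) - C * ?e h / (\<integral>y. C * ?e y \<partial>lborel)\<bar>" .
    qed
    finally show ?thesis by (simp add: d_TV_def)
  qed
  show ?thesis
    unfolding eq using tendsto_mult[OF tendsto_const[of "1/2"] L] by simp
qed

section \<open>Domination of the rescaled likelihood ratio\<close>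

text \<open>
  A product of unnormalised Cauchy densities is the dominating function: its integrability is one-dimensional, and
  it decays only polynomially, so that it also majorises the polynomial tails of the posterior.
\<close>

lemma integrable_prod_inverse_one_plus_square:
  "integrable lborel (\<lambda>h::'a::euclidean_space. \<Prod>b\<in>Basis. inverse (1 + (h \<bullet> b)\<^sup>2))"
proof -
  have "set_integrable lborel (einterval (-\<infinity>) \<infinity>) (\<lambda>x. inverse (1 + x\<^sup>2))"
    by (rule integrable_inverse_1_plus_square)
  then have "integrable lborel (\<lambda>x::real. inverse (1 + x\<^sup>2))"
    by (simp add: set_integrable_def einterval_def)
  then have fin: "(\<integral>\<^sup>+(x::real). ennreal (inverse (1 + x\<^sup>2)) \<partial>lborel) < \<infinity>"
    by (simp add: integrable_iff_bounded add_nonneg_nonneg abs_of_nonneg)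
  have "(\<integral>\<^sup>+(h::'a). ennreal (\<Prod>b\<in>Basis. inverse (1 + (h \<bullet> b)\<^sup>2)) \<partial>lborel) =
      (\<integral>\<^sup>+(h::'a). (\<Prod>b\<in>Basis. ennreal (inverse (1 + (h \<bullet> b)\<^sup>2))) \<partial>lborel)"
    by (intro nn_integral_cong) (simp add: prod_ennreal)
  also have "\<dots> = (\<Prod>b\<in>(Basis::'a set). \<integral>\<^sup>+x. ennreal (inverse (1 + x\<^sup>2)) \<partial>lborel)"
    by (rule nn_integral_lborel_prod) auto
  also have "\<dots> < \<infinity>" using fin by (auto simp: power_less_top_ennreal)
  finally show ?thesis
    by (intro integrableI_nonneg) (auto intro!: AE_I2 prod_nonneg)
qed

lemma prod_one_plus_square_le:
  fixes h :: "'a::euclidean_space"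
  shows "(\<Prod>b\<in>Basis. 1 + (h \<bullet> b)\<^sup>2) \<le> (1 + (norm h)\<^sup>2) ^ DIM('a)"
proof -
  have "(\<Prod>b\<in>Basis. 1 + (h \<bullet> b)\<^sup>2) \<le> (\<Prod>b\<in>(Basis::'a set). 1 + (norm h)\<^sup>2)"
  proof (rule prod_mono)
    fix b :: 'a assume "b \<in> Basis"
    then have "\<bar>h \<bullet> b\<bar>\<^sup>2 \<le> (norm h)\<^sup>2" by (intro power_mono Basis_le_norm) auto
    then show "0 \<le> 1 + (h \<bullet> b)\<^sup>2 \<and> 1 + (h \<bullet> b)\<^sup>2 \<le> 1 + (norm h)\<^sup>2" by simp
  qed
  then show ?thesis by simp
qed

lemma le_prod_inverse_one_plus_square:
  fixes h :: "'a::euclidean_space"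
  assumes "(1 + (norm h)\<^sup>2) ^ DIM('a) * y \<le> C" "0 \<le> y"
  shows "y \<le> C * (\<Prod>b\<in>Basis. inverse (1 + (h \<bullet> b)\<^sup>2))"
proof -
  have pos: "(\<Prod>b\<in>Basis. 1 + (h \<bullet> b)\<^sup>2) > 0" by (intro prod_pos) (simp add: add_pos_nonneg)
  have "(\<Prod>b\<in>Basis. 1 + (h \<bullet> b)\<^sup>2) * y \<le> C"
    using mult_right_mono[OF prod_one_plus_square_le[of h] assms(2)] assms(1) by linarith
  moreover have "(\<Prod>b\<in>Basis. inverse (1 + (h \<bullet> b)\<^sup>2)) = inverse (\<Prod>b\<in>Basis. 1 + (h \<bullet> b)\<^sup>2)"
    using prod_inversef[of "\<lambda>b. 1 + (h \<bullet> b)\<^sup>2" Basis] by (simp only: o_def)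
  ultimately show ?thesis
    using pos by (simp only: divide_inverse[symmetric] pos_le_divide_eq mult.commute)
qed

lemma power_mult_exp_le:
  fixes y c :: real
  assumes "0 \<le> y" "0 < c" "0 < n"
  shows "y ^ n * exp (- c * y) \<le> (n / c) ^ n"
proof -
  have "(c * y / n) ^ n \<le> (1 + c * y / n) ^ n"
    using assms by (intro power_mono) auto
  also have "\<dots> \<le> exp (c * y)"
    using assms by (intro exp_ge_one_plus_x_over_n_power_n) (auto intro: order_trans[of _ 0])
  finally have "y ^ n \<le> exp (c * y) * (n / c) ^ n"
    using assms by (simp add: power_divide power_mult_distrib field_simps)
  then show ?thesis by (simp add: exp_minus field_simps)
qed

lemma gaussian_le_prod_inverse_one_plus_square:
  fixes h :: "'a::euclidean_space"
  assumes c: "0 < c"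
  shows "exp (- c * (norm h)\<^sup>2) \<le>
    exp c * (DIM('a) / c) ^ DIM('a) * (\<Prod>b\<in>Basis. inverse (1 + (h \<bullet> b)\<^sup>2))"
proof (rule le_prod_inverse_one_plus_square)
  have "(1 + (norm h)\<^sup>2) ^ DIM('a) * exp (- c * (norm h)\<^sup>2) =
      exp c * ((1 + (norm h)\<^sup>2) ^ DIM('a) * exp (- c * (1 + (norm h)\<^sup>2)))"
    by (simp add: exp_add[symmetric] algebra_simps)
  also have "\<dots> \<le> exp c * (DIM('a) / c) ^ DIM('a)"
    using c by (intro mult_left_mono power_mult_exp_le) auto
  finally show "(1 + (norm h)\<^sup>2) ^ DIM('a) * exp (- c * (norm h)\<^sup>2) \<le> exp c * (DIM('a) / c) ^ DIM('a)" .
qed simp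

text \<open>
  The condition on \<open>r\<close> makes the lower bound \<open>\<psi>\<close> positive at \<open>r\<close>. As \<open>\<psi>\<close> is
  increasing, the constant \<open>c2\<close> is then at most a fixed multiple of \<open>\<psi> v\<close> for \<open>v \<ge> r\<close>, and so can be
  traded for a smaller factor in front of the logarithm.
\<close>

lemma log_growth_dominates_log:
  fixes c0 c1 c2 r v :: real
  assumes c: "0 < c0" "0 < c1" "0 \<le> c2" "exp (c2 / c0) / c1 < r" and v: "r \<le> v"
  defines "\<psi> \<equiv> \<lambda>v. c0 * ln (1 + c1 * v) - c2"
  defines "\<beta> \<equiv> c0 / (1 + c2 / \<psi> r)"
  shows "\<beta> > 0" "\<psi> v \<ge> \<beta> * ln (1 + c1 * v)"
proof -
  have "exp (c2 / c0) < 1 + c1 * r" using c by (simp add: field_simps)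
  then have "ln (exp (c2 / c0)) < ln (1 + c1 * r)"
    by (subst ln_less_cancel_iff) (auto intro: less_trans[OF exp_gt_zero])
  then have l: "c2 / c0 < ln (1 + c1 * r)" by simp
  then have \<psi>r: "\<psi> r > 0" using c by (simp add: \<psi>_def field_simps)
  then show "\<beta> > 0" using c by (simp add: \<beta>_def add_pos_nonneg)
  have r: "r > 0" using c by (smt (verit) divide_pos_pos exp_gt_zero)
  have "ln (1 + c1 * r) \<le> ln (1 + c1 * v)"
    using c r v by (subst ln_le_cancel_iff) (auto simp: add_pos_pos mult_left_mono)
  then have "\<psi> r \<le> \<psi> v" using c by (simp add: \<psi>_def)
  then have "c2 \<le> c2 / \<psi> r * \<psi> v"
    using \<psi>r c by (simp add: field_simps mult_left_mono)
  then have "c0 * ln (1 + c1 * v) \<le> \<psi> v * (1 + c2 / \<psi> r)"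
    by (simp add: \<psi>_def algebra_simps)
  moreover have "1 + c2 / \<psi> r > 0" using \<psi>r c by (simp add: add_pos_nonneg)
  ultimately show "\<psi> v \<ge> \<beta> * ln (1 + c1 * v)"
    by (simp add: \<beta>_def field_simps)
qed

text \<open>
  With \<open>b = ln (1 + c1 * v)\<close>, the weight \<open>(1 + (norm h)\<^sup>2) ^ p\<close> grows at most like \<open>s ^ (2 * p) * exp (2 * p * b)\<close>.
  One half of the exponent \<open>l * s\<^sup>2 * b\<close> compensates \<open>exp (2 * p * b)\<close>, by the lower bound on \<open>s\<close>; the
  other half is at least a multiple of \<open>s\<^sup>2\<close>, since \<open>v\<close> stays away from \<open>0\<close>, and compensates \<open>s ^ (2 * p)\<close>.
\<close>

lemma tail_le_prod_inverse_one_plus_square: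
  fixes h :: "'a::euclidean_space" and c1 r l s v :: real
  assumes c: "0 < c1" "0 < r" "0 < l" and v: "r \<le> v" and s: "1 \<le> s" "4 * DIM('a) \<le> l * s\<^sup>2"
    and h: "norm h \<le> 2 * s * v"
  shows "exp (- (l * s\<^sup>2) * ln (1 + c1 * v)) \<le>
    (max 1 (2 / c1))\<^sup>2 ^ DIM('a) * (DIM('a) / (l * ln (1 + c1 * r) / 2)) ^ DIM('a) *
      (\<Prod>b\<in>Basis. inverse (1 + (h \<bullet> b)\<^sup>2))"
proof (rule le_prod_inverse_one_plus_square)
  let ?K = "max 1 (2 / c1)" and ?p = "DIM('a)" and ?w = "1 + c1 * v"
  define b b0 where "b = ln ?w" and "b0 = ln (1 + c1 * r)"
  have w1: "?w > 1" using c v by simp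
  have "c1 * r > 0" using c by simp
  then have b0: "b0 > 0" unfolding b0_def by (intro ln_gt_zero) simp
  have bb0: "b \<ge> b0"
    unfolding b_def b0_def using c v by (subst ln_le_cancel_iff) (auto simp: add_pos_pos mult_left_mono)
  have K: "1 + 2 * v \<le> ?K * ?w"
  proof -
    have "2 / c1 * (c1 * v) \<le> ?K * (c1 * v)" using c v by (intro mult_right_mono) auto
    then have "2 * v \<le> ?K * (c1 * v)" using c by simp
    moreover have "1 \<le> ?K" by simp
    ultimately show ?thesis by (simp only: distrib_left mult_1_right)
  qed
  have "1 + (norm h)\<^sup>2 \<le> 1 + (2 * s * v)\<^sup>2" using h by (intro add_left_mono power_mono) auto
  also have "\<dots> \<le> s\<^sup>2 + s\<^sup>2 * (2 * v)\<^sup>2"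
    using s(1) by (simp add: power_mult_distrib mult_ac one_le_power)
  also have "\<dots> \<le> s\<^sup>2 * (1 + 2 * v)\<^sup>2"
    using c v by (simp add: power2_sum distrib_left)
  also have "\<dots> \<le> s\<^sup>2 * (?K * ?w)\<^sup>2"
    using K c v by (intro mult_left_mono power_mono) auto
  finally have "1 + (norm h)\<^sup>2 \<le> s\<^sup>2 * (?K * ?w)\<^sup>2" .
  then have "(1 + (norm h)\<^sup>2) ^ ?p \<le> (s\<^sup>2 * (?K * ?w)\<^sup>2) ^ ?p"
    by (rule power_mono) simp
  also have "\<dots> = (?K\<^sup>2) ^ ?p * ((s\<^sup>2) ^ ?p * exp (2 * ?p * b))"
  proof -
    have "exp (2 * ?p * b) = ?w ^ (2 * ?p)"
      using w1 exp_of_nat_mult[of "2 * ?p" b] by (simp add: b_def)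
    also have "\<dots> = (?w\<^sup>2) ^ ?p" by (rule power_mult)
    finally show ?thesis by (simp add: power_mult_distrib mult_ac)
  qed
  finally have "(1 + (norm h)\<^sup>2) ^ ?p * exp (- (l * s\<^sup>2) * b) \<le>
      (?K\<^sup>2) ^ ?p * ((s\<^sup>2) ^ ?p * exp (2 * ?p * b)) * exp (- (l * s\<^sup>2) * b)"
    by (rule mult_right_mono) simp
  also have "\<dots> = (?K\<^sup>2) ^ ?p * ((s\<^sup>2) ^ ?p * exp (2 * ?p * b - l * s\<^sup>2 * b))"
    by (simp add: exp_diff exp_minus field_simps)
  also have "\<dots> \<le> (?K\<^sup>2) ^ ?p * ((s\<^sup>2) ^ ?p * exp (- (l * b0 / 2) * s\<^sup>2))"
  proof -
    have "4 * real ?p * b \<le> l * s\<^sup>2 * b" using s(2) bb0 b0 by (intro mult_right_mono) auto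
    moreover have "(l * s\<^sup>2) * b0 \<le> (l * s\<^sup>2) * b" using bb0 c by (intro mult_left_mono) auto
    ultimately have "2 * ?p * b - l * s\<^sup>2 * b \<le> - (l * b0 / 2) * s\<^sup>2"
      by (simp add: field_simps)
    then show ?thesis by (intro mult_left_mono) auto
  qed
  also have "\<dots> \<le> (?K\<^sup>2) ^ ?p * (?p / (l * b0 / 2)) ^ ?p"
    using c b0 by (intro mult_left_mono power_mult_exp_le) auto
  finally show "(1 + (norm h)\<^sup>2) ^ ?p * exp (- (l * s\<^sup>2) * ln ?w) \<le>
      (?K\<^sup>2) ^ ?p * (?p / (l * ln (1 + c1 * r) / 2)) ^ ?p"
    by (simp only: b_def b0_def)
qed simp


text \<open>
  The point of the formulation is uniformity: \<open>C\<close> and \<open>Q\<close> depend only on the constants of the two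
  likelihood bounds, not on the sample. The two regions cover the parameter space since, with \<open>t\<close>
  within \<open>r / 2\<close> of \<open>\<theta>s\<close>, every point outside \<open>ball t (2 * r)\<close> lies outside \<open>ball \<theta>s r\<close>.
\<close>

lemma likelihood_ratio_dominated:
  fixes c0 c1 c2 c4 r L :: real and \<gamma> :: "real \<Rightarrow> real"
  assumes c: "0 < c0" "0 < c1" "0 \<le> c2" "exp (c2 / c0) / c1 < r" "0 < L" "0 < c4"
    and \<gamma>: "\<And>v. r \<le> v \<Longrightarrow> c0 * ln (1 + c1 * v) - c2 \<le> \<gamma> v"
  obtains C Q :: real where
    "\<And>(F :: 'a::euclidean_space \<Rightarrow> real) \<Theta> t \<theta>s m A a h.
      \<lbrakk>\<And>\<theta>. \<theta> \<in> \<Theta> \<Longrightarrow> 0 \<le> F \<theta>; 0 < F t; F \<theta>s \<le> F t;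
       \<And>\<theta>. \<theta> \<in> \<Theta> \<inter> ball t (2 * r) \<Longrightarrow> F \<theta> \<le> F t * exp (- m * c4 * (norm (\<theta> - t))\<^sup>2);
       \<And>\<theta>. \<theta> \<in> \<Theta> - ball \<theta>s r \<Longrightarrow> F \<theta> \<le> F \<theta>s * exp (- L * m * \<gamma> (norm (\<theta> - \<theta>s)));
       dist t \<theta>s \<le> r / 2; 0 < A; 0 < m; Q \<le> A * m; A / 2 \<le> a;
       t + (1 / sqrt (A * m)) *\<^sub>R h \<in> \<Theta>\<rbrakk> \<Longrightarrow>
      (F (t + (1 / sqrt (A * m)) *\<^sub>R h) / F t) powr a \<le> C * (\<Prod>b\<in>Basis. inverse (1 + (h \<bullet> b)\<^sup>2))"
proof -
  define \<beta> where "\<beta> = c0 / (1 + c2 / (c0 * ln (1 + c1 * r) - c2))"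
  define l where "l = L * \<beta> / 2"
  note growth = log_growth_dominates_log[OF c(1-4), folded \<beta>_def]
  have \<beta>: "\<beta> > 0" using growth(1)[of r] by simp
  then have l: "l > 0" using c by (simp add: l_def)
  have r: "r > 0" using c by (smt (verit) divide_pos_pos exp_gt_zero)
  define Q where "Q = max 1 (4 * DIM('a) / l)"
  define C1 where "C1 = exp (c4 / 2) * (DIM('a) / (c4 / 2)) ^ DIM('a)"
  define C2 where "C2 = (max 1 (2 / c1))\<^sup>2 ^ DIM('a) * (DIM('a) / (l * ln (1 + c1 * r) / 2)) ^ DIM('a)"
  show thesis
  proof (rule that[of Q "max C1 C2"])
    fix F :: "'a \<Rightarrow> real" and \<Theta> t \<theta>s m A a h
    assume nonneg: "\<And>\<theta>. \<theta> \<in> \<Theta> \<Longrightarrow> 0 \<le> F \<theta>" and Ft: "0 < F t" and mle: "F \<theta>s \<le> F t"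
      and inner: "\<And>\<theta>. \<theta> \<in> \<Theta> \<inter> ball t (2 * r) \<Longrightarrow> F \<theta> \<le> F t * exp (- m * c4 * (norm (\<theta> - t))\<^sup>2)"
      and outer: "\<And>\<theta>. \<theta> \<in> \<Theta> - ball \<theta>s r \<Longrightarrow> F \<theta> \<le> F \<theta>s * exp (- L * m * \<gamma> (norm (\<theta> - \<theta>s)))"
      and near: "dist t \<theta>s \<le> r / 2" and A: "0 < A" and m: "0 < m" and Q: "Q \<le> A * m" and a: "A / 2 \<le> a"
    define s where "s = sqrt (A * m)"
    define \<theta> where "\<theta> = t + (1 / sqrt (A * m)) *\<^sub>R h"
    assume "t + (1 / sqrt (A * m)) *\<^sub>R h \<in> \<Theta>"
    then have \<theta>\<Theta>: "\<theta> \<in> \<Theta>" by (simp add: \<theta>_def)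
    have s2: "s\<^sup>2 = A * m" using A m by (simp add: s_def)
    have s1: "s \<ge> 1" using Q by (simp add: Q_def s_def)
    have a0: "a > 0" using a A by simp
    have am: "A * m / 2 \<le> a * m" using a m mult_right_mono[of "A / 2" a m] by simp
    have hn: "norm h = s * norm (\<theta> - t)" using s1 by (simp add: \<theta>_def s_def[symmetric])
    let ?P = "\<Prod>b\<in>Basis. inverse (1 + (h \<bullet> b)\<^sup>2)"
    have P: "?P \<ge> 0" by (intro prod_nonneg) simp
    have powr_le: "(F \<theta> / F t) powr a \<le> exp (x * a)" if "F \<theta> \<le> F t * exp x" for x
    proof -
      have "F \<theta> / F t \<le> exp x" using that Ft by (simp add: field_simps)
      then have "(F \<theta> / F t) powr a \<le> exp x powr a"
        using nonneg[OF \<theta>\<Theta>] Ft a0 by (intro powr_mono2) auto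
      then show ?thesis by (simp add: exp_powr_real)
    qed
    have "(F \<theta> / F t) powr a \<le> max C1 C2 * ?P"
    proof (cases "\<theta> \<in> ball t (2 * r)")
      case True
      have "(F \<theta> / F t) powr a \<le> exp (- m * c4 * (norm (\<theta> - t))\<^sup>2 * a)"
        using \<theta>\<Theta> True by (intro powr_le inner) auto
      also have "\<dots> \<le> exp (- (c4 / 2) * (norm h)\<^sup>2)"
      proof -
        have "A * m / 2 * (c4 * (norm (\<theta> - t))\<^sup>2) \<le> a * m * (c4 * (norm (\<theta> - t))\<^sup>2)"
          using am c by (intro mult_right_mono) auto
        then show ?thesis by (simp add: hn power_mult_distrib s2 mult_ac)
      qed
      also have "\<dots> \<le> C1 * ?P"
        unfolding C1_def by (rule gaussian_le_prod_inverse_one_plus_square) (use c in simp)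
      also have "\<dots> \<le> max C1 C2 * ?P" using P by (intro mult_right_mono) auto
      finally show ?thesis .
    next
      case False
      define v where "v = norm (\<theta> - \<theta>s)"
      have d: "norm (\<theta> - t) \<ge> 2 * r" using False by (simp add: dist_norm norm_minus_commute)
      have tri: "norm (\<theta> - t) \<le> v + r / 2"
        using near norm_triangle_ineq[of "\<theta> - \<theta>s" "\<theta>s - t"]
        by (simp add: v_def dist_norm norm_minus_commute)
      have v: "v \<ge> r" using d tri r by linarith
      have "norm h \<le> s * (2 * v)"
        unfolding hn using tri v s1 r by (intro mult_left_mono) linarith+
      then have h: "norm h \<le> 2 * s * v" by (simp add: mult_ac)
      have "F \<theta> \<le> F \<theta>s * exp (- L * m * \<gamma> v)"
        unfolding v_def using \<theta>\<Theta> v by (intro outer) (simp add: v_def dist_norm norm_minus_commute)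
      also have "\<dots> \<le> F t * exp (- L * m * \<gamma> v)" using mle by (intro mult_right_mono) auto
      finally have "(F \<theta> / F t) powr a \<le> exp (- L * m * \<gamma> v * a)" by (rule powr_le)
      also have "\<dots> \<le> exp (- (l * s\<^sup>2) * ln (1 + c1 * v))"
      proof -
        have ln0: "ln (1 + c1 * v) \<ge> 0" using c v r by simp
        have "\<beta> * ln (1 + c1 * v) \<le> \<gamma> v" using growth(2)[OF v] \<gamma>[OF v] by linarith
        then have "A * m / 2 * (L * (\<beta> * ln (1 + c1 * v))) \<le> a * m * (L * \<gamma> v)"
          using am c \<beta> ln0 A m a0 by (intro mult_mono mult_left_mono) auto
        then show ?thesis by (simp add: l_def s2 mult_ac)
      qed
      also have "\<dots> \<le> C2 * ?P"
        unfolding C2_def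
      proof (rule tail_le_prod_inverse_one_plus_square[OF c(2) r l v s1 _ h])
        have "4 * DIM('a) / l \<le> s\<^sup>2" using Q by (simp add: Q_def s2)
        then show "real (4 * DIM('a)) \<le> l * s\<^sup>2" using l by (simp add: field_simps)
      qed
      also have "\<dots> \<le> max C1 C2 * ?P" using P by (intro mult_right_mono) auto
      finally show ?thesis .
    qed
    then show "(F (t + (1 / sqrt (A * m)) *\<^sub>R h) / F t) powr a \<le> max C1 C2 * ?P"
      by (simp add: \<theta>_def)
  qed
qed

section \<open>The posterior along a sequence of fixed samples\<close>

text \<open>
  The total variation limit without randomness: \<open>F k\<close> is the likelihood of the \<open>k\<close>-th sample, of
  size \<open>m k\<close>, with MLE \<open>t k\<close>; \<open>a k\<close> is the exponent of the posterior and \<open>A k\<close> the one that sets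
  the scale.
\<close>

lemma posterior_TV_limit:
  fixes F :: "nat \<Rightarrow> real ^ 'p \<Rightarrow> real" and t :: "nat \<Rightarrow> real ^ 'p" and a A m :: "nat \<Rightarrow> real"
    and c0 c1 c2 c4 r L \<kappa> :: real and \<pi> :: "real ^ 'p \<Rightarrow> real"
  assumes c: "0 < c0" "0 < c1" "0 \<le> c2" "exp (c2 / c0) / c1 < r" "0 < L" "0 < c4"
    and \<gamma>: "\<And>v. r \<le> v \<Longrightarrow> c0 * ln (1 + c1 * v) - c2 \<le> \<gamma> v"
    and V: "pos_def_matrix V" and \<Theta>: "open \<Theta>" "\<theta>s \<in> \<Theta>"
    and nonneg: "\<And>k \<theta>. \<theta> \<in> \<Theta> \<Longrightarrow> 0 \<le> F k \<theta>" and pos: "\<And>k. 0 < F k \<theta>s"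
    and mle: "\<And>k \<theta>. \<theta> \<in> \<Theta> \<Longrightarrow> F k \<theta> \<le> F k (t k)"
    and inner: "\<And>k \<theta>. \<theta> \<in> \<Theta> \<inter> ball (t k) (2 * r) \<Longrightarrow>
      F k \<theta> \<le> F k (t k) * exp (- m k * c4 * (norm (\<theta> - t k))\<^sup>2)"
    and outer: "\<And>k \<theta>. \<theta> \<in> \<Theta> - ball \<theta>s r \<Longrightarrow>
      F k \<theta> \<le> F k \<theta>s * exp (- L * m k * \<gamma> (norm (\<theta> - \<theta>s)))"
    and t: "t \<longlonglongrightarrow> \<theta>s" and Am: "\<And>k. 0 < A k" "\<And>k. 0 < m k"
    and Am_inf: "filterlim (\<lambda>k. A k * m k) at_top sequentially"
    and ratio: "(\<lambda>k. a k / A k) \<longlonglongrightarrow> 1"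
    and lan: "\<And>h. \<forall>\<^sub>F k in sequentially. 0 < F k (t k + (1 / sqrt (A k * m k)) *\<^sub>R h)"
      "\<And>h. (\<lambda>k. A k * (ln (F k (t k + (1 / sqrt (A k * m k)) *\<^sub>R h)) - ln (F k (t k))))
        \<longlonglongrightarrow> - (1/2) * (h \<bullet> (V *v h))"
    and \<pi>: "isCont \<pi> \<theta>s" "0 < \<pi> \<theta>s" "\<And>\<theta>. \<theta> \<in> \<Theta> \<Longrightarrow> 0 \<le> \<pi> \<theta>" "\<And>\<theta>. \<theta> \<in> \<Theta> \<Longrightarrow> \<pi> \<theta> \<le> \<kappa>"
    and int: "\<And>k. set_integrable lborel \<Theta> (\<lambda>\<theta>. F k \<theta> powr a k * \<pi> \<theta>)"
  shows "(\<lambda>k. d_TV (\<lambda>\<theta>. indicator \<Theta> \<theta> * (F k \<theta> powr a k * \<pi> \<theta>) /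
        (LINT \<theta>:\<Theta>|lborel. F k \<theta> powr a k * \<pi> \<theta>))
      (mvn_density (t k) ((1 / (A k * m k)) *\<^sub>R matrix_inv V))) \<longlonglongrightarrow> 0"
proof -
  define s where "s k = sqrt (A k * m k)" for k
  define q where "q k \<theta> = indicator \<Theta> \<theta> * (F k \<theta> powr a k * \<pi> \<theta>)" for k \<theta>
  have s: "s k > 0" for k using Am by (simp add: s_def)
  have s2: "(s k)\<^sup>2 = A k * m k" for k using Am[of k] by (simp add: s_def)
  have Ft: "0 < F k (t k)" for k using pos mle[OF \<Theta>(2)] by (rule less_le_trans)
  have s_inf: "filterlim s at_top sequentially"
    unfolding s_def by (rule filterlim_compose[OF sqrt_at_top Am_inf])
  have "(\<lambda>k. 1 / s k) \<longlonglongrightarrow> 0"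
    by (rule tendsto_divide_0[OF tendsto_const filterlim_at_top_imp_at_infinity[OF s_inf]])
  then have \<theta>lim: "(\<lambda>k. t k + (1 / s k) *\<^sub>R h) \<longlonglongrightarrow> \<theta>s" for h
    using tendsto_add[OF t tendsto_scaleR[OF _ tendsto_const]] by fastforce
  have lim: "(\<lambda>k. q k (t k + (1 / s k) *\<^sub>R h) / F k (t k) powr a k) \<longlonglongrightarrow>
      \<pi> \<theta>s * exp (- (1/2) * (h \<bullet> (V *v h)))" for h
  proof -
    let ?\<theta> = "\<lambda>k. t k + (1 / s k) *\<^sub>R h"
    have "\<forall>\<^sub>F k in sequentially. ?\<theta> k \<in> \<Theta>"
      by (rule topological_tendstoD[OF \<theta>lim \<Theta>])
    moreover have "\<forall>\<^sub>F k in sequentially. 0 < F k (?\<theta> k)" using lan(1) by (simp add: s_def)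
    ultimately have "\<forall>\<^sub>F k in sequentially.
        exp ((a k / A k) * (A k * (ln (F k (?\<theta> k)) - ln (F k (t k))))) * \<pi> (?\<theta> k) =
        q k (?\<theta> k) / F k (t k) powr a k"
    proof eventually_elim
      case (elim k)
      then show ?case using Ft[of k] Am(1)[of k]
        by (simp add: q_def powr_def exp_diff right_diff_distrib)
    qed
    moreover have "(\<lambda>k. exp ((a k / A k) * (A k * (ln (F k (?\<theta> k)) - ln (F k (t k))))) * \<pi> (?\<theta> k))
        \<longlonglongrightarrow> exp (1 * (- (1/2) * (h \<bullet> (V *v h)))) * \<pi> \<theta>s"
      using lan(2)[of h] unfolding s_def[symmetric]
      by (intro tendsto_mult[OF tendsto_exp[OF tendsto_mult[OF ratio]]
            isCont_tendsto_compose[OF \<pi>(1) \<theta>lim]])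
    ultimately show ?thesis
      by (auto intro: Lim_transform_eventually simp: mult.commute)
  qed
  obtain C Q where CQ: "\<And>k h. \<lbrakk>dist (t k) \<theta>s \<le> r / 2; Q \<le> A k * m k; A k / 2 \<le> a k;
       t k + (1 / s k) *\<^sub>R h \<in> \<Theta>\<rbrakk> \<Longrightarrow>
      (F k (t k + (1 / s k) *\<^sub>R h) / F k (t k)) powr a k \<le> C * (\<Prod>b\<in>Basis. inverse (1 + (h \<bullet> b)\<^sup>2))"
  proof -
    show thesis
    proof (rule likelihood_ratio_dominated[OF c, of \<gamma>, where ?'a = "real ^ 'p"], erule \<gamma>)
      fix C Q :: real
      assume *: "\<And>(F :: real ^ 'p \<Rightarrow> real) \<Theta> t \<theta>s m A a h.
        \<lbrakk>\<And>\<theta>. \<theta> \<in> \<Theta> \<Longrightarrow> 0 \<le> F \<theta>; 0 < F t; F \<theta>s \<le> F t;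
         \<And>\<theta>. \<theta> \<in> \<Theta> \<inter> ball t (2 * r) \<Longrightarrow> F \<theta> \<le> F t * exp (- m * c4 * (norm (\<theta> - t))\<^sup>2);
         \<And>\<theta>. \<theta> \<in> \<Theta> - ball \<theta>s r \<Longrightarrow> F \<theta> \<le> F \<theta>s * exp (- L * m * \<gamma> (norm (\<theta> - \<theta>s)));
         dist t \<theta>s \<le> r / 2; 0 < A; 0 < m; Q \<le> A * m; A / 2 \<le> a;
         t + (1 / sqrt (A * m)) *\<^sub>R h \<in> \<Theta>\<rbrakk> \<Longrightarrow>
        (F (t + (1 / sqrt (A * m)) *\<^sub>R h) / F t) powr a \<le> C * (\<Prod>b\<in>Basis. inverse (1 + (h \<bullet> b)\<^sup>2))"
      show thesis
      proof (rule that)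
        fix k h
        assume "dist (t k) \<theta>s \<le> r / 2" "Q \<le> A k * m k" "A k / 2 \<le> a k" "t k + (1 / s k) *\<^sub>R h \<in> \<Theta>"
        then show "(F k (t k + (1 / s k) *\<^sub>R h) / F k (t k)) powr a k \<le>
            C * (\<Prod>b\<in>Basis. inverse (1 + (h \<bullet> b)\<^sup>2))"
          unfolding s_def by (intro *[of \<Theta> "F k" "t k" \<theta>s "m k" "A k" "a k" h] nonneg Ft mle[OF \<Theta>(2)] inner outer Am)
      qed
    qed
  qed
  have "0 < r / 2" using c by (smt (verit) divide_pos_pos exp_gt_zero)
  then have "\<forall>\<^sub>F k in sequentially. dist (t k) \<theta>s < r / 2" by (rule tendstoD[OF t])
  moreover have "\<forall>\<^sub>F k in sequentially. Q \<le> A k * m k"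
    using Am_inf by (simp add: filterlim_at_top)
  moreover have "\<forall>\<^sub>F k in sequentially. 1 / 2 < a k / A k"
    by (rule order_tendstoD(1)[OF ratio]) simp
  ultimately have dom: "\<forall>\<^sub>F k in sequentially. \<forall>h. \<bar>q k (t k + (1 / s k) *\<^sub>R h) / F k (t k) powr a k\<bar> \<le>
      \<kappa> * (\<bar>C\<bar> * (\<Prod>b\<in>Basis. inverse (1 + (h \<bullet> b)\<^sup>2)))"
  proof eventually_elim
    case (elim k)
    have a: "A k / 2 \<le> a k" using elim(3) Am(1)[of k] by (simp add: field_simps)
    have \<kappa>: "\<kappa> > 0" using \<pi>(2) \<pi>(4)[OF \<Theta>(2)] by linarith
    show ?case
    proof
      fix h
      let ?\<theta> = "t k + (1 / s k) *\<^sub>R h" and ?P = "\<Prod>b\<in>Basis. inverse (1 + (h \<bullet> b)\<^sup>2)"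
      have P: "?P \<ge> 0" by (intro prod_nonneg) simp
      show "\<bar>q k ?\<theta> / F k (t k) powr a k\<bar> \<le> \<kappa> * (\<bar>C\<bar> * ?P)"
      proof (cases "?\<theta> \<in> \<Theta>")
        case True
        have "\<bar>q k ?\<theta> / F k (t k) powr a k\<bar> = \<pi> ?\<theta> * (F k ?\<theta> / F k (t k)) powr a k"
          using True nonneg[OF True, of k] Ft[of k] \<pi>(3)[OF True] by (simp add: q_def powr_divide)
        also have "\<dots> \<le> \<kappa> * (C * ?P)"
          using CQ[OF _ elim(2) a True] elim(1) \<pi>(3,4)[OF True] \<kappa> by (intro mult_mono) auto
        also have "\<dots> \<le> \<kappa> * (\<bar>C\<bar> * ?P)"
          using P \<kappa> by (intro mult_left_mono mult_right_mono) auto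
        finally show ?thesis .
      next
        case False
        then show ?thesis using P \<kappa> by (simp add: q_def)
      qed
    qed
  qed
  have "integrable lborel (q k)" for k
    using int[of k] by (simp add: set_integrable_def q_def[abs_def])
  then have meas: "q k \<in> borel_measurable borel" for k
    using borel_measurable_integrable by fastforce
  have D: "integrable lborel (\<lambda>h::real ^ 'p. \<kappa> * (\<bar>C\<bar> * (\<Prod>b\<in>Basis. inverse (1 + (h \<bullet> b)\<^sup>2))))"
    by (intro integrable_mult_right integrable_prod_inverse_one_plus_square)
  have "(\<lambda>k. d_TV (\<lambda>\<theta>. q k \<theta> / (\<integral>\<theta>. q k \<theta> \<partial>lborel))
      (mvn_density (t k) ((1 / (s k)\<^sup>2) *\<^sub>R matrix_inv V))) \<longlonglongrightarrow> 0"
    by (rule d_TV_rescaled_limit[OF V s _ \<pi>(2) meas lim dom D]) (simp add: Ft less_imp_neq[symmetric])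
  then show ?thesis
    by (simp add: q_def s2 set_lebesgue_integral_def)
qed

section \<open>Convergence in outer probability\<close>

lemma outer_prob_mono:
  assumes "\<And>x. x \<in> space M \<Longrightarrow> E x \<Longrightarrow> E' x"
  shows "outer_prob M E \<le> outer_prob M E'"
  unfolding outer_prob_def using assms by (intro outer_measure_of_mono) auto

lemma outer_prob_disj_le: "outer_prob M (\<lambda>x. E x \<or> E' x) \<le> outer_prob M E + outer_prob M E'"
proof -
  obtain A where A: "A \<in> sets M" "{x \<in> space M. E x} \<subseteq> A" "outer_prob M E = emeasure M A"
    unfolding outer_prob_def using outer_measure_of_attain[of "{x \<in> space M. E x}" M] by auto
  obtain B where B: "B \<in> sets M" "{x \<in> space M. E' x} \<subseteq> B" "outer_prob M E' = emeasure M B"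
    unfolding outer_prob_def using outer_measure_of_attain[of "{x \<in> space M. E' x}" M] by auto
  have "outer_prob M (\<lambda>x. E x \<or> E' x) \<le> outer_measure_of M (A \<union> B)"
    unfolding outer_prob_def using A(2) B(2) by (intro outer_measure_of_mono) auto
  also have "\<dots> = emeasure M (A \<union> B)" using A(1) B(1) by simp
  also have "\<dots> \<le> emeasure M A + emeasure M B" using A(1) B(1) by (rule emeasure_subadditive)
  finally show ?thesis using A(3) B(3) by simp
qed

lemma outer_prob_AE:
  assumes "AE x in M. E x"
  shows "outer_prob M (\<lambda>x. \<not> E x) = 0"
proof -
  obtain N where N: "{x \<in> space M. \<not> E x} \<subseteq> N" "N \<in> null_sets M"
    using assms by (auto elim: AE_E3 simp: eventually_ae_filter)
  have "outer_prob M (\<lambda>x. \<not> E x) \<le> outer_measure_of M N"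
    unfolding outer_prob_def by (rule outer_measure_of_mono[OF N(1)])
  also have "\<dots> = 0" using N(2) by (simp add: null_setsD1 null_setsD2)
  finally show ?thesis by simp
qed

lemma with_prob_tending_to_one_conj:
  assumes "with_prob_tending_to_one P E" "with_prob_tending_to_one P E'"
  shows "with_prob_tending_to_one P (\<lambda>n x. E n x \<and> E' n x)"
  unfolding with_prob_tending_to_one_def
proof (rule tendsto_sandwich[OF _ _ tendsto_const])
  show "(\<lambda>n. outer_prob (P n) (\<lambda>x. \<not> E n x) + outer_prob (P n) (\<lambda>x. \<not> E' n x)) \<longlonglongrightarrow> 0"
    using tendsto_add[OF assms[unfolded with_prob_tending_to_one_def]] by simp
  show "\<forall>\<^sub>F n in sequentially. outer_prob (P n) (\<lambda>x. \<not> (E n x \<and> E' n x)) \<le>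
      outer_prob (P n) (\<lambda>x. \<not> E n x) + outer_prob (P n) (\<lambda>x. \<not> E' n x)"
    unfolding de_Morgan_conj by (intro always_eventually allI outer_prob_disj_le)
qed simp

lemma with_prob_tending_to_one_mono:
  assumes "with_prob_tending_to_one P E" "\<And>n x. x \<in> space (P n) \<Longrightarrow> E n x \<Longrightarrow> E' n x"
  shows "with_prob_tending_to_one P E'"
  unfolding with_prob_tending_to_one_def
proof (rule tendsto_sandwich[OF _ _ tendsto_const])
  show "(\<lambda>n. outer_prob (P n) (\<lambda>x. \<not> E n x)) \<longlonglongrightarrow> 0"
    using assms(1) by (simp add: with_prob_tending_to_one_def)
  show "\<forall>\<^sub>F n in sequentially. outer_prob (P n) (\<lambda>x. \<not> E' n x) \<le> outer_prob (P n) (\<lambda>x. \<not> E n x)"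
    using assms(2) by (auto intro!: always_eventually outer_prob_mono)
qed simp

lemma with_prob_tending_to_one_AE:
  assumes "\<forall>n\<ge>1. AE x in P n. E n x"
  shows "with_prob_tending_to_one P E"
  unfolding with_prob_tending_to_one_def
proof (rule tendsto_eventually)
  show "\<forall>\<^sub>F n in sequentially. outer_prob (P n) (\<lambda>x. \<not> E n x) = 0"
    using eventually_ge_at_top[of 1] by eventually_elim (use assms in \<open>blast intro: outer_prob_AE\<close>)
qed

lemma tendsto_in_prob_iff:
  "tendsto_in_prob P Y c \<longleftrightarrow> (\<forall>\<epsilon>>0. with_prob_tending_to_one P (\<lambda>n x. dist (Y n x) c \<le> \<epsilon>))"
  by (simp add: tendsto_in_prob_def with_prob_tending_to_one_def not_le)

text \<open>
  A bridge from deterministic to stochastic limits: if the conclusion holds along every sequence of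
  samples that are \<open>G \<eta>\<close>-good with \<open>\<eta>\<close> tending to zero, then some \<open>G \<eta>\<close> already forces it up to
  \<open>\<epsilon>\<close>, for otherwise counterexamples could be collected into such a sequence.
\<close>

lemma tendsto_in_prob_by_sequences:
  assumes good: "\<And>\<eta>. \<eta> > 0 \<Longrightarrow> with_prob_tending_to_one P (G \<eta>)"
    and seq: "\<And>N X. \<lbrakk>\<And>k. k < N k; \<And>k. X k \<in> space (P (N k)); \<And>k. G (1 / real (Suc k)) (N k) (X k)\<rbrakk> \<Longrightarrow>
      (\<lambda>k. Y (N k) (X k)) \<longlonglongrightarrow> c"
  shows "tendsto_in_prob P Y c"
  unfolding tendsto_in_prob_def
proof (intro allI impI)
  fix \<epsilon> :: real assume \<epsilon>: "\<epsilon> > 0"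
  have "\<exists>k. \<forall>n>k. \<forall>x\<in>space (P n). G (1 / real (Suc k)) n x \<longrightarrow> dist (Y n x) c \<le> \<epsilon>"
  proof (rule ccontr)
    assume "\<not> ?thesis"
    then have "\<forall>k. \<exists>n x. k < n \<and> x \<in> space (P n) \<and> G (1 / real (Suc k)) n x \<and> \<epsilon> < dist (Y n x) c"
      by (meson not_le)
    then obtain N X where NX: "\<And>k. k < N k" "\<And>k. X k \<in> space (P (N k))"
      "\<And>k. G (1 / real (Suc k)) (N k) (X k)" "\<And>k. \<epsilon> < dist (Y (N k) (X k)) c"
      by metis
    have "(\<lambda>k. Y (N k) (X k)) \<longlonglongrightarrow> c" using NX(1-3) by (rule seq)
    then obtain k where "dist (Y (N k) (X k)) c < \<epsilon>"
      using \<epsilon> by (metis (no_types, lifting) eventually_happens tendstoD trivial_limit_sequentially)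
    with NX(4)[of k] show False by simp
  qed
  then obtain k where k: "\<And>n x. k < n \<Longrightarrow> x \<in> space (P n) \<Longrightarrow> G (1 / real (Suc k)) n x \<Longrightarrow> dist (Y n x) c \<le> \<epsilon>"
    by blast
  show "(\<lambda>n. outer_prob (P n) (\<lambda>x. \<epsilon> < dist (Y n x) c)) \<longlonglongrightarrow> 0"
  proof (rule tendsto_sandwich[OF _ _ tendsto_const])
    show "(\<lambda>n. outer_prob (P n) (\<lambda>x. \<not> G (1 / real (Suc k)) n x)) \<longlonglongrightarrow> 0"
      using good[of "1 / real (Suc k)"] by (simp add: with_prob_tending_to_one_def)
    show "\<forall>\<^sub>F n in sequentially. outer_prob (P n) (\<lambda>x. \<epsilon> < dist (Y n x) c) \<le>
        outer_prob (P n) (\<lambda>x. \<not> G (1 / real (Suc k)) n x)"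
      using eventually_gt_at_top[of k]
    proof eventually_elim
      case (elim n)
      then show ?case using k by (intro outer_prob_mono) (meson not_le)
    qed
  qed simp
qed

text \<open>
  Weak convergence implies tightness, tested on the continuous functions \<open>g K\<close> that rise from \<open>0\<close> to
  \<open>1\<close> between the radii \<open>K\<close> and \<open>K + 1\<close>. Testing on the constant \<open>1\<close> shows that the limit \<open>N\<close> has
  total mass one, which makes dominated convergence under \<open>N\<close> possible.
\<close>

lemma scaled_tendsto_in_prob_zero:
  fixes Y :: "nat \<Rightarrow> 'a \<Rightarrow> 'b::euclidean_space"
  assumes prob: "\<And>n. n \<ge> 1 \<Longrightarrow> prob_space (P n)"
    and meas: "\<And>n. n \<ge> 1 \<Longrightarrow> Y n \<in> borel_measurable (P n)"
    and dist: "tendsto_in_distribution P Y N" and N: "sets N = sets borel"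
    and b: "b \<longlonglongrightarrow> 0"
  shows "tendsto_in_prob P (\<lambda>n x. b n *\<^sub>R Y n x) 0"
proof -
  have lim: "(\<lambda>n. \<integral>x. g (Y n x) \<partial>P n) \<longlonglongrightarrow> (\<integral>z. g z \<partial>N)"
    if "continuous_on UNIV g" "bounded (range g)" for g :: "'b \<Rightarrow> real"
    using dist that by (simp add: tendsto_in_distribution_def)
  have "(\<lambda>n. \<integral>x. 1 \<partial>P n) \<longlonglongrightarrow> (\<integral>z. (1::real) \<partial>N)"
    by (rule lim) (auto intro: continuous_intros)
  moreover have "(\<lambda>n. \<integral>x. 1 \<partial>P n) \<longlonglongrightarrow> (1::real)"
  proof (rule tendsto_eventually)
    show "\<forall>\<^sub>F n in sequentially. (\<integral>x. 1 \<partial>P n) = (1::real)"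
      using eventually_ge_at_top[of 1]
      by eventually_elim (simp add: prob prob_space.prob_space)
  qed
  ultimately have "(\<integral>z. (1::real) \<partial>N) = 1"
    by (rule LIMSEQ_unique)
  then have "measure N (space N) = 1" by simp
  then have "emeasure N (space N) \<noteq> \<infinity>" by (auto simp: measure_def)
  then interpret N: finite_measure N by (rule finite_measureI)
  define g where "g K z = min 1 (max 0 (norm z - real K))" for K and z :: 'b
  have g_cont: "continuous_on UNIV (g K)" for K
    unfolding g_def by (intro continuous_intros)
  have g_bd: "0 \<le> g K z" "g K z \<le> 1" for K z by (auto simp: g_def)
  have g_bdd: "bounded (range (g K))" for K
    unfolding bounded_iff using g_bd by (intro exI[of _ 1]) auto
  have g_meas[measurable]: "g K \<in> borel_measurable borel" for K
    using g_cont by (rule borel_measurable_continuous_onI)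
  have "(\<lambda>K. \<integral>z. g K z \<partial>N) \<longlonglongrightarrow> (\<integral>z. 0 \<partial>N)"
  proof (rule integral_dominated_convergence[where w="\<lambda>_. 1"])
    show "AE z in N. (\<lambda>K. g K z) \<longlonglongrightarrow> 0"
    proof (rule AE_I2, rule tendsto_eventually)
      fix z :: 'b
      obtain K0 :: nat where "norm z \<le> real K0" using real_arch_simple by blast
      then have "g K z = 0" if "K \<ge> K0" for K
        using that by (simp add: g_def)
      then show "\<forall>\<^sub>F K in sequentially. g K z = 0"
        using eventually_ge_at_top[of K0] by (rule eventually_mono[rotated])
    qed
  qed (use g_bd N in \<open>auto simp: measurable_cong_sets[OF N refl]\<close>)
  then have g0: "(\<lambda>K. \<integral>z. g K z \<partial>N) \<longlonglongrightarrow> 0" by simp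
  show ?thesis
    unfolding tendsto_in_prob_def
  proof (intro allI impI)
    fix \<epsilon> :: real assume \<epsilon>: "\<epsilon> > 0"
    let ?S = "\<lambda>n. {x \<in> space (P n). \<epsilon> < dist (b n *\<^sub>R Y n x) 0}"
    have S: "?S n \<in> sets (P n)" if "n \<ge> 1" for n
      using meas[OF that] by measurable
    have "(\<lambda>n. measure (P n) (?S n)) \<longlonglongrightarrow> 0"
    proof (rule LIMSEQ_I)
      fix \<delta> :: real assume "\<delta> > 0"
      then have "\<forall>\<^sub>F K in sequentially. (\<integral>z. g K z \<partial>N) < \<delta>"
        by (rule order_tendstoD(2)[OF g0])
      then obtain K where "(\<integral>z. g K z \<partial>N) < \<delta>" by (meson eventually_happens trivial_limit_sequentially)
      then have "\<forall>\<^sub>F n in sequentially. (\<integral>x. g K (Y n x) \<partial>P n) < \<delta>"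
        by (rule order_tendstoD(2)[OF lim[OF g_cont g_bdd]])
      moreover have "\<forall>\<^sub>F n in sequentially. norm (b n) < \<epsilon> / (real K + 1)"
        using tendstoD[OF b, of "\<epsilon> / (real K + 1)"] \<epsilon> by (simp add: add_nonneg_pos)
      ultimately have "\<forall>\<^sub>F n in sequentially. norm (measure (P n) (?S n) - 0) < \<delta>"
        using eventually_ge_at_top[of 1]
      proof eventually_elim
        case (elim n)
        interpret prob_space "P n" using elim(3) by (rule prob)
        note [measurable] = meas[OF elim(3)]
        have "indicat_real (?S n) x \<le> g K (Y n x)" if "x \<in> space (P n)" for x
        proof (cases "x \<in> ?S n")
          case True
          then have "\<epsilon> < \<bar>b n\<bar> * norm (Y n x)" by simp
          also have "\<dots> \<le> \<epsilon> / (real K + 1) * norm (Y n x)"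
            using elim(2) by (intro mult_right_mono) auto
          finally have "\<epsilon> * (real K + 1) < \<epsilon> * norm (Y n x)" by (simp add: field_simps)
          then have "real K + 1 < norm (Y n x)" using \<epsilon> by (simp only: mult_less_cancel_left_pos)
          then show ?thesis using True by (simp add: g_def)
        next
          case False
          then show ?thesis using g_bd by simp
        qed
        then have "(\<integral>x. indicat_real (?S n) x \<partial>P n) \<le> (\<integral>x. g K (Y n x) \<partial>P n)"
        proof (intro integral_mono)
          show "integrable (P n) (indicat_real (?S n))"
            by (intro integrable_real_indicator S[OF elim(3)]) (simp add: emeasure_eq_measure)
          show "integrable (P n) (\<lambda>x. g K (Y n x))"
            using g_bd by (intro integrable_const_bound[where B=1]) auto
        qed
        also have "(\<integral>x. indicat_real (?S n) x \<partial>P n) = measure (P n) (?S n)"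
          using S[OF elim(3)] sets.sets_into_space by (simp add: Int_absorb2)
        finally show ?case using elim(1) by simp
      qed
      then show "\<exists>no. \<forall>n\<ge>no. norm (measure (P n) (?S n) - 0) < \<delta>"
        by (simp add: eventually_sequentially)
    qed
    then have "(\<lambda>n. ennreal (measure (P n) (?S n))) \<longlonglongrightarrow> 0"
      using tendsto_ennrealI by fastforce
    moreover have "\<forall>\<^sub>F n in sequentially. ennreal (measure (P n) (?S n)) =
        outer_prob (P n) (\<lambda>x. \<epsilon> < dist (b n *\<^sub>R Y n x) 0)"
      using eventually_ge_at_top[of 1]
    proof eventually_elim
      case (elim n)
      interpret prob_space "P n" using elim by (rule prob)
      show ?case using S[OF elim] by (simp add: outer_prob_def emeasure_eq_measure)
    qed
    ultimately show "(\<lambda>n. outer_prob (P n) (\<lambda>x. \<epsilon> < dist (b n *\<^sub>R Y n x) 0)) \<longlonglongrightarrow> 0"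
      by (rule Lim_transform_eventually)
  qed
qed

section \<open>Likelihood bounds and quadratic expansion\<close>

lemma loglik_ratio_leD:
  assumes "loglik_ratio f n x \<theta> \<theta>' \<le> ereal y" "0 < f n x \<theta>'" "0 \<le> f n x \<theta>"
  shows "f n x \<theta> \<le> f n x \<theta>' * exp y"
proof (cases "0 < f n x \<theta>")
  case True
  then have "ln (f n x \<theta>) \<le> ln (f n x \<theta>' * exp y)"
    using assms by (simp add: loglik_ratio_def loglik_def ln_mult)
  then show ?thesis using True assms(2) by simp
next
  case False
  then show ?thesis using assms(2,3) by (simp add: order_antisym)
qed

text \<open>
  A vanishing likelihood at either parameter makes the extended real remainder infinite, so
  finiteness of the remainder yields positivity as well as the real-valued estimate.
\<close>

lemma LAN_remainder_leD:
  assumes "\<bar>LAN_remainder f \<theta>hat \<theta>s V \<alpha> n x h\<bar> \<le> ereal \<eta>" and \<alpha>: "0 < \<alpha> n"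
  defines "\<theta> \<equiv> \<theta>s + (1 / sqrt (\<alpha> n * real n)) *\<^sub>R h"
  shows "0 < f n x \<theta>s" "0 < f n x \<theta>"
    "\<bar>\<alpha> n * (ln (f n x \<theta>) - ln (f n x \<theta>s)) - h \<bullet> (V *v (sqrt (\<alpha> n * real n) *\<^sub>R (\<theta>hat n x - \<theta>s)))
      + (1/2) * (h \<bullet> (V *v h))\<bar> \<le> \<eta>"
proof -
  have *: "\<bar>ereal (\<alpha> n) * loglik_ratio f n x \<theta> \<theta>s
     - ereal (sqrt (\<alpha> n) * (h \<bullet> (V *v (sqrt (real n) *\<^sub>R (\<theta>hat n x - \<theta>s)))))
     + ereal ((1/2) * (h \<bullet> (V *v h)))\<bar> \<le> ereal \<eta>"
    using assms(1) unfolding LAN_remainder_def \<theta>_def .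
  show s: "0 < f n x \<theta>s"
  proof (rule ccontr)
    assume "\<not> ?thesis"
    then have "loglik_ratio f n x \<theta> \<theta>s = \<infinity>" by (simp add: loglik_ratio_def loglik_def)
    then show False using * \<alpha> by simp
  qed
  show p: "0 < f n x \<theta>"
  proof (rule ccontr)
    assume "\<not> ?thesis"
    then have "loglik_ratio f n x \<theta> \<theta>s = - \<infinity>" using s by (simp add: loglik_ratio_def loglik_def)
    then show False using * \<alpha> by simp
  qed
  show "\<bar>\<alpha> n * (ln (f n x \<theta>) - ln (f n x \<theta>s)) - h \<bullet> (V *v (sqrt (\<alpha> n * real n) *\<^sub>R (\<theta>hat n x - \<theta>s)))
      + (1/2) * (h \<bullet> (V *v h))\<bar> \<le> \<eta>"
    using * s p by (simp add: loglik_ratio_def loglik_def real_sqrt_mult matrix_vector_mult_scaleR mult.assoc)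
qed

lemma admissible_exponents_at_top:
  assumes "admissible_exponents \<alpha>"
  shows "filterlim (\<lambda>n. \<alpha> n * real n) at_top sequentially"
proof -
  have "\<forall>\<^sub>F n in sequentially. 0 < (1 / real n) / \<alpha> n"
    using eventually_ge_at_top[of 1] by eventually_elim (use assms in \<open>auto simp: admissible_exponents_def\<close>)
  then have "filterlim (\<lambda>n. inverse ((1 / real n) / \<alpha> n)) at_top sequentially"
    using assms by (intro filterlim_inverse_at_top) (auto simp: admissible_exponents_def)
  then show ?thesis by (simp add: field_simps)
qed

lemma prob_space_true_law:
  assumes "is_density (sample_space \<nu> n) (f0 n)"
  shows "prob_space (true_law \<nu> f0 n)"
  using assms by (intro prob_spaceI) (auto simp: true_law_def emeasure_density is_density_def cong: nn_integral_cong)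

text \<open>
  Recentring the expansion at the MLE: \<open>\<theta>\<close> and the MLE are the points with local coordinates \<open>h + u\<close>
  and \<open>u\<close> around \<open>\<theta>s\<close>. The coefficient of the linear term is \<open>V *v u\<close>, so the difference of the two
  expansions has no term linear in \<open>h\<close>.
\<close>

lemma local_quadratic_at_MLE:
  fixes V :: "real ^ 'p ^ 'p" and h :: "real ^ 'p"
  assumes V: "pos_def_matrix V" and \<alpha>: "0 < \<alpha> n" "0 < n"
    and R: "\<And>h. h \<in> cball 0 \<rho> \<Longrightarrow> \<bar>LAN_remainder f \<theta>hat \<theta>s V \<alpha> n x h\<bar> \<le> ereal \<eta>"
    and u: "norm (sqrt (\<alpha> n * real n) *\<^sub>R (\<theta>hat n x - \<theta>s)) \<le> \<eta>" and \<rho>: "norm h + \<eta> \<le> \<rho>"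
  defines "\<theta> \<equiv> \<theta>hat n x + (1 / sqrt (\<alpha> n * real n)) *\<^sub>R h"
  shows "0 < f n x \<theta>s" "0 < f n x \<theta>"
    "\<bar>\<alpha> n * (ln (f n x \<theta>) - ln (f n x (\<theta>hat n x))) + (1/2) * (h \<bullet> (V *v h))\<bar> \<le> 2 * \<eta>"
proof -
  define s where "s = sqrt (\<alpha> n * real n)"
  define u where "u = s *\<^sub>R (\<theta>hat n x - \<theta>s)"
  have s: "s > 0" using \<alpha> by (simp add: s_def)
  have eq: "\<theta>s + (1 / s) *\<^sub>R (h + u) = \<theta>" "\<theta>s + (1 / s) *\<^sub>R u = \<theta>hat n x"
    using s by (simp_all add: \<theta>_def u_def s_def[symmetric] scaleR_add_right)
  have un: "norm u \<le> \<eta>" using assms(5) by (simp add: u_def s_def)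
  have "h + u \<in> cball 0 \<rho>" using un \<rho> norm_triangle_ineq[of h u] by simp
  note R1 = LAN_remainder_leD[OF R[OF this] \<alpha>(1), folded s_def, folded u_def, unfolded eq]
  have "u \<in> cball 0 \<rho>" using un \<rho> norm_ge_zero[of h] unfolding mem_cball_0 by linarith
  note R2 = LAN_remainder_leD[OF R[OF this] \<alpha>(1), folded s_def, folded u_def, unfolded eq]
  show "0 < f n x \<theta>s" "0 < f n x \<theta>" by (fact R1)+
  have sym: "u \<bullet> (V *v h) = h \<bullet> (V *v u)"
    using V by (metis dot_lmul_matrix inner_commute pos_def_matrix_def transpose_matrix_vector)
  have quad: "(h + u) \<bullet> (V *v u) - (1/2) * ((h + u) \<bullet> (V *v (h + u))) - (u \<bullet> (V *v u) - (1/2) * (u \<bullet> (V *v u))) =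
      - (1/2) * (h \<bullet> (V *v h))"
    by (simp add: matrix_vector_right_distrib inner_add_left inner_add_right sym field_simps)
  have "\<alpha> n * (ln (f n x \<theta>) - ln (f n x (\<theta>hat n x))) =
      \<alpha> n * (ln (f n x \<theta>) - ln (f n x \<theta>s)) - \<alpha> n * (ln (f n x (\<theta>hat n x)) - ln (f n x \<theta>s))"
    by (simp add: algebra_simps)
  then show "\<bar>\<alpha> n * (ln (f n x \<theta>) - ln (f n x (\<theta>hat n x))) + (1/2) * (h \<bullet> (V *v h))\<bar> \<le> 2 * \<eta>"
    using R1(3) R2(3) quad by linarith
qed

lemma LAN_remainder_uniformly_small:
  assumes A2: "assumption_A2 P f \<theta>hat \<theta>s V" and \<alpha>: "admissible_exponents \<alpha>" and "0 < \<rho>" "0 < \<eta>"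
  shows "with_prob_tending_to_one P
    (\<lambda>n x. \<forall>h\<in>cball 0 \<rho>. \<bar>LAN_remainder f \<theta>hat \<theta>s V \<alpha> n x h\<bar> \<le> ereal \<eta>)"
proof -
  have "with_prob_tending_to_one P
      (\<lambda>n x. \<bar>SUP h\<in>cball 0 \<rho>. \<bar>LAN_remainder f \<theta>hat \<theta>s V \<alpha> n x h\<bar>\<bar> \<le> ereal \<eta>)"
    using assms by (simp add: assumption_A2_def ereal_vanishes_in_prob_def with_prob_tending_to_one_def not_le)
  then show ?thesis
  proof (rule with_prob_tending_to_one_mono, intro ballI)
    fix n x and h :: "real ^ 'b"
    assume le: "\<bar>SUP h\<in>cball 0 \<rho>. \<bar>LAN_remainder f \<theta>hat \<theta>s V \<alpha> n x h\<bar>\<bar> \<le> ereal \<eta>" and h: "h \<in> cball 0 \<rho>"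
    have "\<bar>LAN_remainder f \<theta>hat \<theta>s V \<alpha> n x h\<bar> \<le> (SUP h\<in>cball 0 \<rho>. \<bar>LAN_remainder f \<theta>hat \<theta>s V \<alpha> n x h\<bar>)"
      using h by (rule SUP_upper)
    also have "\<dots> \<le> \<bar>\<dots>\<bar>" by (cases "SUP h\<in>cball 0 \<rho>. \<bar>LAN_remainder f \<theta>hat \<theta>s V \<alpha> n x h\<bar>") auto
    finally show "\<bar>LAN_remainder f \<theta>hat \<theta>s V \<alpha> n x h\<bar> \<le> ereal \<eta>" using le by (rule order_trans)
  qed
qed

section \<open>Normal approximation of the posterior with data-dependent exponent\<close>

theorem corollary1:
  fixes \<X> :: "(real ^ 'd) set" and \<nu> :: "(real ^ 'd) measure"
    and \<Theta> :: "(real ^ 'p) set"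
    and f0 :: "nat \<Rightarrow> 'd sample \<Rightarrow> real"
    and f :: "('d, 'p) model"
    and \<pi> :: "real ^ 'p \<Rightarrow> real"
    and \<theta>hat :: "nat \<Rightarrow> 'd sample \<Rightarrow> real ^ 'p" and \<theta>s :: "real ^ 'p"
    and V :: "real ^ 'p ^ 'p"
    and L c0 c1 c2 r \<kappa> :: real and \<gamma> :: "real \<Rightarrow> real"
    and \<alpha> :: "nat \<Rightarrow> real" and \<alpha>hat :: "nat \<Rightarrow> 'd sample \<Rightarrow> real"
  defines "P \<equiv> true_law \<nu> f0"
  assumes setting: "model_setting \<X> \<nu> \<Theta> f0 f \<pi>"
    and A0: "assumption_A0 P \<Theta> f \<theta>hat \<theta>s"
    and A1: "assumption_A1 \<pi> \<theta>s"
    and A2: "assumption_A2 P f \<theta>hat \<theta>s V"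
    and A3: "assumption_A3 P \<Theta> f \<pi> \<theta>s"
    and C1: "condition_1 P \<Theta> f \<theta>s L c0 c1 c2 r \<gamma>"
    and C2: "condition_2 P \<Theta> f \<theta>hat r"
    and \<kappa>: "0 < \<kappa>" "\<forall>\<theta>\<in>\<Theta>. \<pi> \<theta> \<le> \<kappa>"
    and \<alpha>: "admissible_exponents \<alpha>"
    and \<alpha>hat: "\<forall>n\<ge>1. \<alpha>hat n \<in> borel_measurable (P n)"
      "\<forall>n\<ge>1. \<forall>x\<in>space (P n). 0 < \<alpha>hat n x"
      "tendsto_in_prob P (\<lambda>n x. \<alpha>hat n x / \<alpha> n) 1"
  shows "tendsto_in_prob P
           (\<lambda>n x. d_TV (alpha_posterior \<Theta> f \<pi> n (\<alpha>hat n x) x)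
                       (mvn_density (\<theta>hat n x) ((1 / (\<alpha> n * real n)) *\<^sub>R matrix_inv V)))
           0"
proof -
  have \<alpha>_pos: "0 < \<alpha> n" if "n \<ge> 1" for n using \<alpha> that by (simp add: admissible_exponents_def)
  have V: "pos_def_matrix V" using A2 by (simp add: assumption_A2_def)
  have \<theta>s: "\<theta>s \<in> \<Theta>" using A0 by (simp add: assumption_A0_def)
  have \<Theta>: "open \<Theta>" using setting by (simp add: model_setting_def)
  have c: "0 < L" "0 < c0" "0 < c1" "0 \<le> c2" "exp (c2 / c0) / c1 < r"
    and \<gamma>: "\<And>v. r \<le> v \<Longrightarrow> c0 * ln (1 + c1 * v) - c2 \<le> \<gamma> v"
    and outer: "with_prob_tending_to_one P (\<lambda>n x. \<forall>\<theta>\<in>\<Theta> - ball \<theta>s r.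
      loglik_ratio f n x \<theta> \<theta>s \<le> ereal (- L * real n * \<gamma> (norm (\<theta> - \<theta>s))))"
    using C1 unfolding condition_1_def by blast+
  obtain c3 c4 where c4: "0 < c4" and inner0: "with_prob_tending_to_one P
       (\<lambda>n x. \<forall>\<theta>\<in>\<Theta> \<inter> ball (\<theta>hat n x) (2 * r).
          ereal (- real n * c3 * (norm (\<theta> - \<theta>hat n x))\<^sup>2) \<le> loglik_ratio f n x \<theta> (\<theta>hat n x) \<and>
          loglik_ratio f n x \<theta> (\<theta>hat n x) \<le> ereal (- real n * c4 * (norm (\<theta> - \<theta>hat n x))\<^sup>2))"
    using C2 unfolding condition_2_def by blast
  have inner: "with_prob_tending_to_one P (\<lambda>n x. \<forall>\<theta>\<in>\<Theta> \<inter> ball (\<theta>hat n x) (2 * r).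
      loglik_ratio f n x \<theta> (\<theta>hat n x) \<le> ereal (- real n * c4 * (norm (\<theta> - \<theta>hat n x))\<^sup>2))"
    using inner0 by (rule with_prob_tending_to_one_mono) blast
  have \<pi>: "isCont \<pi> \<theta>s" "0 < \<pi> \<theta>s"
    using A1 by (auto simp: assumption_A1_def continuous_on_eq_continuous_at)
  have \<pi>_nonneg: "0 \<le> \<pi> \<theta>" if "\<theta> \<in> \<Theta>" for \<theta>
    using setting that by (auto simp: model_setting_def is_density_def space_restrict_space)
  have f_nonneg: "0 \<le> f n x \<theta>" if "n \<ge> 1" "x \<in> space (P n)" "\<theta> \<in> \<Theta>" for n x \<theta>
    using setting that by (auto simp: model_setting_def is_density_def P_def true_law_def)
  have prob: "prob_space (P n)" if "n \<ge> 1" for n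
    using setting that unfolding P_def by (intro prob_space_true_law) (simp add: model_setting_def)
  have u: "tendsto_in_prob P (\<lambda>n x. sqrt (\<alpha> n) *\<^sub>R (sqrt (real n) *\<^sub>R (\<theta>hat n x - \<theta>s))) 0"
  proof -
    obtain mu \<Sigma> where D: "tendsto_in_distribution P (\<lambda>n x. sqrt (real n) *\<^sub>R (\<theta>hat n x - \<theta>s))
        (density lborel (\<lambda>z. ennreal (mvn_density mu \<Sigma> z)))"
      using A0 by (auto simp: assumption_A0_def)
    have "(\<lambda>n. sqrt (\<alpha> n)) \<longlonglongrightarrow> sqrt 0"
      using \<alpha> by (intro tendsto_real_sqrt) (simp add: admissible_exponents_def)
    then show ?thesis
      using A0 by (intro scaled_tendsto_in_prob_zero[OF prob _ D]) (auto simp: assumption_A0_def)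
  qed
  \<comment> \<open>The parameter \<open>\<eta>\<close> controls the errors and, through \<open>1 / \<eta>\<close>, the ball on which the expansion is
    used, so that \<open>\<eta>\<close> tending to zero covers every fixed \<open>h\<close> eventually.\<close>
  define G where "G \<eta> n x \<longleftrightarrow>
     (\<forall>a>0. proper_posterior \<Theta> f \<pi> n a x) \<and> is_unique_MLE \<Theta> f n x (\<theta>hat n x) \<and>
     dist (\<theta>hat n x) \<theta>s \<le> \<eta> \<and> dist (\<alpha>hat n x / \<alpha> n) 1 \<le> \<eta> \<and>
     dist (sqrt (\<alpha> n) *\<^sub>R (sqrt (real n) *\<^sub>R (\<theta>hat n x - \<theta>s))) 0 \<le> \<eta> \<and>
     (\<forall>h\<in>cball 0 (1 / \<eta>). \<bar>LAN_remainder f \<theta>hat \<theta>s V \<alpha> n x h\<bar> \<le> ereal \<eta>) \<and>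
     (\<forall>\<theta>\<in>\<Theta> - ball \<theta>s r. loglik_ratio f n x \<theta> \<theta>s \<le> ereal (- L * real n * \<gamma> (norm (\<theta> - \<theta>s)))) \<and>
     (\<forall>\<theta>\<in>\<Theta> \<inter> ball (\<theta>hat n x) (2 * r).
       loglik_ratio f n x \<theta> (\<theta>hat n x) \<le> ereal (- real n * c4 * (norm (\<theta> - \<theta>hat n x))\<^sup>2))"
    for \<eta> n x
  show ?thesis
  proof (rule tendsto_in_prob_by_sequences[where G=G])
    fix \<eta> :: real assume \<eta>: "\<eta> > 0"
    show "with_prob_tending_to_one P (G \<eta>)"
      unfolding G_def
    proof (intro with_prob_tending_to_one_conj)
      show "with_prob_tending_to_one P (\<lambda>n x. \<forall>a>0. proper_posterior \<Theta> f \<pi> n a x)"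
        using setting unfolding P_def model_setting_def by (intro with_prob_tending_to_one_AE) blast
      show "with_prob_tending_to_one P (\<lambda>n x. is_unique_MLE \<Theta> f n x (\<theta>hat n x))"
        using A0 by (intro with_prob_tending_to_one_AE) (simp add: assumption_A0_def)
      show "with_prob_tending_to_one P (\<lambda>n x. dist (\<theta>hat n x) \<theta>s \<le> \<eta>)"
        using A0 \<eta> by (simp add: assumption_A0_def tendsto_in_prob_iff)
      show "with_prob_tending_to_one P (\<lambda>n x. dist (\<alpha>hat n x / \<alpha> n) 1 \<le> \<eta>)"
        using \<alpha>hat(3) \<eta> by (simp add: tendsto_in_prob_iff)
      show "with_prob_tending_to_one P
          (\<lambda>n x. dist (sqrt (\<alpha> n) *\<^sub>R (sqrt (real n) *\<^sub>R (\<theta>hat n x - \<theta>s))) 0 \<le> \<eta>)"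
        using u[unfolded tendsto_in_prob_iff] \<eta> by blast
      show "with_prob_tending_to_one P
          (\<lambda>n x. \<forall>h\<in>cball 0 (1 / \<eta>). \<bar>LAN_remainder f \<theta>hat \<theta>s V \<alpha> n x h\<bar> \<le> ereal \<eta>)"
        using \<eta> by (intro LAN_remainder_uniformly_small[OF A2 \<alpha>]) auto
    qed (fact outer inner)+
  next
    fix N X
    assume N: "\<And>k. k < N k" and X: "\<And>k. X k \<in> space (P (N k))"
      and good: "\<And>k. G (1 / real (Suc k)) (N k) (X k)"
    have N1: "N k \<ge> 1" for k using N[of k] by simp
    have N_inf: "filterlim N at_top sequentially"
      by (rule filterlim_at_top_mono[OF filterlim_ident]) (intro always_eventually allI less_imp_le N)
    have \<eta>0: "(\<lambda>k. 1 / real (Suc k)) \<longlonglongrightarrow> 0"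
      using LIMSEQ_inverse_real_of_nat by (simp add: inverse_eq_divide)
    note good = good[unfolded G_def]
    let ?F = "\<lambda>k. f (N k) (X k)" and ?t = "\<lambda>k. \<theta>hat (N k) (X k)"
    let ?A = "\<lambda>k. \<alpha> (N k)" and ?m = "\<lambda>k. real (N k)" and ?a = "\<lambda>k. \<alpha>hat (N k) (X k)"
    have squeeze: "g \<longlonglongrightarrow> l" if "\<And>k. dist (g k) l \<le> 1 / real (Suc k)" for g :: "nat \<Rightarrow> 'b::metric_space" and l
      using that by (intro metric_tendsto_imp_tendsto[OF \<eta>0]) (auto intro!: always_eventually)
    have mle: "?F k \<theta> \<le> ?F k (?t k)" if "\<theta> \<in> \<Theta>" for k \<theta>
      using good[of k] that by (auto simp: is_unique_MLE_def is_arg_max_def not_less)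
    have quad: "0 < ?F k \<theta>s" "0 < ?F k (?t k + (1 / sqrt (?A k * ?m k)) *\<^sub>R h)"
      "\<bar>?A k * (ln (?F k (?t k + (1 / sqrt (?A k * ?m k)) *\<^sub>R h)) - ln (?F k (?t k))) + (1/2) * (h \<bullet> (V *v h))\<bar>
        \<le> 2 * (1 / real (Suc k))"
      if h: "norm h + 1 \<le> real (Suc k)" for k h
    proof -
      have size: "norm h + 1 / real (Suc k) \<le> 1 / (1 / real (Suc k))"
      proof -
        have "1 / real (Suc k) \<le> 1" by simp
        moreover have "1 / (1 / real (Suc k)) = real (Suc k)" by simp
        ultimately show ?thesis using h by linarith
      qed
      have near: "norm (sqrt (?A k * ?m k) *\<^sub>R (?t k - \<theta>s)) \<le> 1 / real (Suc k)"
        using good[of k] by (simp add: real_sqrt_mult)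
      have lan: "\<And>h. h \<in> cball 0 (1 / (1 / real (Suc k))) \<Longrightarrow>
          \<bar>LAN_remainder f \<theta>hat \<theta>s V \<alpha> (N k) (X k) h\<bar> \<le> ereal (1 / real (Suc k))"
        using good[of k] by blast
      have "0 < N k" using N[of k] by simp
      note loc = local_quadratic_at_MLE[where \<alpha>=\<alpha> and n="N k" and x="X k" and h=h,
          OF V \<alpha>_pos[OF N1] this lan near size]
      show "0 < ?F k \<theta>s" "0 < ?F k (?t k + (1 / sqrt (?A k * ?m k)) *\<^sub>R h)"
        "\<bar>?A k * (ln (?F k (?t k + (1 / sqrt (?A k * ?m k)) *\<^sub>R h)) - ln (?F k (?t k))) + (1/2) * (h \<bullet> (V *v h))\<bar>
          \<le> 2 * (1 / real (Suc k))"
        by (rule loc; assumption)+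
    qed
    have Fs: "0 < ?F k \<theta>s" for k using quad(1)[of 0] by simp
    have Ft: "0 < ?F k (?t k)" for k using Fs mle[OF \<theta>s] by (rule less_le_trans)
    have h_ev: "\<forall>\<^sub>F k in sequentially. norm h + 1 \<le> real (Suc k)" for h :: "real ^ 'p"
    proof -
      obtain K :: nat where "norm h + 1 \<le> real K" using real_arch_simple by blast
      then have "norm h + 1 \<le> real (Suc k)" if "K \<le> k" for k using that by simp
      then show ?thesis by (rule eventually_mono[OF eventually_ge_at_top])
    qed
    have "(\<lambda>k. d_TV (\<lambda>\<theta>. indicator \<Theta> \<theta> * (?F k \<theta> powr ?a k * \<pi> \<theta>) /
          (LINT \<theta>:\<Theta>|lborel. ?F k \<theta> powr ?a k * \<pi> \<theta>))
        (mvn_density (?t k) ((1 / (?A k * ?m k)) *\<^sub>R matrix_inv V))) \<longlonglongrightarrow> 0"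
    proof (rule posterior_TV_limit[OF c(2-5) c(1) c4, of \<gamma>])
      show "?F k \<theta> \<le> ?F k (?t k) * exp (- ?m k * c4 * (norm (\<theta> - ?t k))\<^sup>2)"
        if "\<theta> \<in> \<Theta> \<inter> ball (?t k) (2 * r)" for k \<theta>
        using good[of k] that f_nonneg[OF N1 X] Ft by (intro loglik_ratio_leD) auto
      show "?F k \<theta> \<le> ?F k \<theta>s * exp (- L * ?m k * \<gamma> (norm (\<theta> - \<theta>s)))"
        if "\<theta> \<in> \<Theta> - ball \<theta>s r" for k \<theta>
        using good[of k] that f_nonneg[OF N1 X] Fs by (intro loglik_ratio_leD) auto
      show "?t \<longlonglongrightarrow> \<theta>s" "(\<lambda>k. ?a k / ?A k) \<longlonglongrightarrow> 1"
        using good by (intro squeeze, blast)+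
      show "filterlim (\<lambda>k. ?A k * ?m k) at_top sequentially"
        by (rule filterlim_compose[OF admissible_exponents_at_top[OF \<alpha>] N_inf])
      show "\<forall>\<^sub>F k in sequentially. 0 < ?F k (?t k + (1 / sqrt (?A k * ?m k)) *\<^sub>R h)" for h
        using h_ev[of h] by eventually_elim (rule quad(2))
      show "(\<lambda>k. ?A k * (ln (?F k (?t k + (1 / sqrt (?A k * ?m k)) *\<^sub>R h)) - ln (?F k (?t k))))
        \<longlonglongrightarrow> - (1/2) * (h \<bullet> (V *v h))" for h
      proof (rule metric_tendsto_imp_tendsto)
        show "(\<lambda>k. 2 * (1 / real (Suc k))) \<longlonglongrightarrow> 0"
          using tendsto_mult[OF tendsto_const[of 2] \<eta>0] by simp
        show "\<forall>\<^sub>F k in sequentially.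
          dist (?A k * (ln (?F k (?t k + (1 / sqrt (?A k * ?m k)) *\<^sub>R h)) - ln (?F k (?t k)))) (- (1/2) * (h \<bullet> (V *v h)))
            \<le> dist (2 * (1 / real (Suc k))) 0"
          using h_ev[of h] by eventually_elim (use quad(3) in \<open>simp add: dist_real_def\<close>)
      qed
      show "set_integrable lborel \<Theta> (\<lambda>\<theta>. ?F k \<theta> powr ?a k * \<pi> \<theta>)" for k
        using good[of k] \<alpha>hat(2) N1 X by (auto simp: proper_posterior_def)
    qed (use \<gamma> V \<Theta> \<theta>s f_nonneg[OF N1 X] Fs mle \<alpha>_pos[OF N1] N1 \<pi> \<pi>_nonneg \<kappa>(2) in
        \<open>auto simp: Suc_le_eq\<close>)
    then show "(\<lambda>k. d_TV (alpha_posterior \<Theta> f \<pi> (N k) (?a k) (X k))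
        (mvn_density (?t k) ((1 / (?A k * ?m k)) *\<^sub>R matrix_inv V))) \<longlonglongrightarrow> 0"
      by (simp add: alpha_posterior_def[abs_def] posterior_norm_const_def)
  qed
qed

end
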